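(* Let $n\geq 4$ and let $G_0\in\mathfrak{C}'_{n,1}$ satisfy $F(G_0)=\min\{F(G): G\in\mathfrak{C}'_{n,1}\}$. Then $G_0\cong L_{n,n-1}$.
   Context: All graphs are simple, finite, undirected and connected. $F(G)$ is the number of connected subgraphs of $G$ (nonempty, connected subgraphs, i.e. a vertex subset together with a subset of the edges among them; distinct subgraphs counted separately, so $F(C_n)=n^2+1$). $\mathfrak{C}_{n,k}$ is the family of connected graphs on $n$ vertices with exactly $k$ cut vertices, and $\mathfrak{C}'_{n,k}$ consists of those graphs in $\mathfrak{C}_{n,k}$ that are not trees. $L_{n,n-1}$ is the cycle $C_{n-1}$ with one additional pendant vertex adjacent to a vertex of the cycle. *)

theory Defs
  imports "Graph_Theory.Graph_Theory"
begin

text \<open>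
  A finite simple undirected graph is a \<^const>\<open>pair_graph\<close>: a finite, loop-free, symmetric digraph
  without parallel arcs, an undirected edge being the two opposite arcs between its ends.
  Accordingly, a subgraph in the undirected sense is a \<^const>\<open>subgraph\<close> that is again a
  \<^const>\<open>pair_graph\<close>. Note that \<^const>\<open>Digraph_Component.connected\<close> excludes the empty graph.
\<close>

definition connected_subgraphs :: "'a pair_pre_digraph \<Rightarrow> 'a pair_pre_digraph set" where
  "connected_subgraphs G =
     {H. pair_graph H \<and> subgraph (with_proj H) (with_proj G) \<and>
         Digraph_Component.connected (with_proj H)}"

definition F :: "'a pair_pre_digraph \<Rightarrow> nat" where
  "F G = card (connected_subgraphs G)"

definition cut_vertex :: "'a pair_pre_digraph \<Rightarrow> 'a \<Rightarrow> bool" where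
  "cut_vertex G v \<longleftrightarrow> v \<in> pverts G \<and>
     (\<exists>x \<in> pverts G - {v}. \<exists>y \<in> pverts G - {v}.
        x \<rightarrow>\<^sup>*\<^bsub>with_proj G\<^esub> y \<and> \<not> x \<rightarrow>\<^sup>*\<^bsub>pre_digraph.del_vert (with_proj G) v\<^esub> y)"

text \<open>
  The library's \<^const>\<open>forest\<close> and \<^const>\<open>tree\<close> speak about directed cycles, and both arcs
  of a single undirected edge form a directed cycle of length 2. The cycles of an undirected
  simple graph are the directed cycles of length at least 3.
\<close>

definition undirected_tree :: "'a pair_pre_digraph \<Rightarrow> bool" where
  "undirected_tree G \<longleftrightarrow> Digraph_Component.connected (with_proj G) \<and>
     \<not> (\<exists>p. pre_digraph.cycle (with_proj G) p \<and> 3 \<le> length p)"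

definition graphs_with_cut_vertices :: "nat \<Rightarrow> nat \<Rightarrow> 'a pair_pre_digraph set" where
  "graphs_with_cut_vertices n k =
     {G. pair_graph G \<and> Digraph_Component.connected (with_proj G) \<and>
         card (pverts G) = n \<and> card {v. cut_vertex G v} = k}"

definition non_tree_graphs_with_cut_vertices :: "nat \<Rightarrow> nat \<Rightarrow> 'a pair_pre_digraph set" where
  "non_tree_graphs_with_cut_vertices n k =
     {G \<in> graphs_with_cut_vertices n k. \<not> undirected_tree G}"

text \<open>
  The graph $L_{n,n-1}$: the cycle $0, 1, \ldots, n-2$ with the pendant vertex $n-1$ attached to $0$
  (meaningful for $n \geq 4$).
\<close>

definition L_graph :: "nat \<Rightarrow> nat pair_pre_digraph" where
  "L_graph n =
     (let A = {(i, i + 1) | i. i + 1 < n - 1} \<union> {(n - 2, 0)} \<union> {(0, n - 1)}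
      in \<lparr> pverts = {..<n}, parcs = A \<union> A\<inverse> \<rparr>)"

text \<open>
  \<^const>\<open>F\<close> takes only finitely many values on graphs with \<open>n\<close> vertices, so that
  \<^const>\<open>Min\<close> is meaningful there even if the vertex type is infinite.
\<close>

lemma F_le:
  assumes "pair_graph G"
  shows "F G \<le> 2 ^ card (pverts G) * 2 ^ (card (pverts G) * card (pverts G))"
proof -
  interpret pair_graph G by fact
  let ?V = "pverts G"
  let ?S = "Pow ?V \<times> Pow (?V \<times> ?V)"
  have fin: "finite ?V" by (rule pair_finite_verts)
  have "parcs G \<subseteq> ?V \<times> ?V"
    using arc_fst_in_verts arc_snd_in_verts by (metis mem_Times_iff subsetI)
  then have "(\<lambda>H. (pverts H, parcs H)) ` connected_subgraphs G \<subseteq> ?S"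
    by (auto simp: connected_subgraphs_def subgraph_def)
  moreover have "inj_on (\<lambda>H. (pverts H, parcs H)) (connected_subgraphs G)"
    by (auto intro!: inj_onI pair_pre_digraph.equality)
  ultimately have "F G \<le> card ?S"
    unfolding F_def using fin by (intro card_inj_on_le) auto
  also have "\<dots> = 2 ^ card ?V * 2 ^ (card ?V * card ?V)"
    using fin by (simp add: card_cartesian_product card_Pow)
  finally show ?thesis .
qed

lemma finite_F_values:
  "finite (F ` (non_tree_graphs_with_cut_vertices n k :: 'a pair_pre_digraph set))"
proof (rule finite_subset)
  show "F ` (non_tree_graphs_with_cut_vertices n k :: 'a pair_pre_digraph set) \<subseteq> {..2 ^ n * 2 ^ (n * n)}"
    using F_le by (fastforce simp: non_tree_graphs_with_cut_vertices_def graphs_with_cut_vertices_def)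
qed simp

end

theory Submission
  imports Defs
begin

text \<open>
  Let \<open>v\<close> be the cut vertex, \<open>A\<close> a component of \<open>G - v\<close> with \<open>a \<ge> 2\<close> vertices (it exists because
  some edge of a cycle avoids \<open>v\<close>) and \<open>B\<close> the set of the remaining \<open>b \<ge> 1\<close> vertices. No vertex of
  \<open>A\<close> or \<open>B\<close> is a cut vertex, which forces at least \<open>1 + a(a+1)/2\<close> connected vertex sets containing
  \<open>v\<close> inside \<open>A + v\<close>, and likewise for \<open>B\<close>; these multiply. Moreover \<open>A + v\<close> induces a bridgeless graph
  with \<open>q \<ge> a + 1\<close> edges, and deleting one of them from the subgraph induced by \<open>A + v\<close> and a
  connected set of \<open>B + v\<close> gives further connected subgraphs. The connected subsets of \<open>A\<close> and the
  single vertices of \<open>B\<close> complete the lower bound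
  \<open>(1 + a(a+1)/2 + q)(1 + b(b+1)/2) + a(a+1)/2 + b\<close>, which exceeds the value at the lollipop unless
  \<open>b = 1\<close> and \<open>q = a + 1\<close>. In that case \<open>A + v\<close> is two-regular, hence a cycle.
\<close>

section \<open>Connectivity by cuts\<close>

text \<open>
  The root \<open>S\<close> need not be connected: it plays the role of a single contracted vertex.
\<close>

definition grows :: "'a rel \<Rightarrow> 'a set \<Rightarrow> 'a set \<Rightarrow> bool" where
  "grows E S X \<longleftrightarrow> S \<subseteq> X \<and> (\<forall>Y. S \<subseteq> Y \<and> Y \<subset> X \<longrightarrow> (\<exists>y\<in>Y. \<exists>z\<in>X - Y. (y, z) \<in> E))"

text \<open>Growth is required from every vertex, so that every nonempty proper subset has an arc
  leaving it (\<open>linkedD\<close>). For symmetric relations a single root suffices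
  (\<open>grows_imp_linked\<close>).\<close>

definition linked :: "'a rel \<Rightarrow> 'a set \<Rightarrow> bool" where
  "linked E X \<longleftrightarrow> X \<noteq> {} \<and> (\<forall>x\<in>X. grows E {x} X)"

lemma growsI:
  assumes "S \<subseteq> X" "\<And>Y. S \<subseteq> Y \<Longrightarrow> Y \<subset> X \<Longrightarrow> \<exists>y\<in>Y. \<exists>z\<in>X - Y. (y, z) \<in> E"
  shows "grows E S X"
  using assms by (auto simp: grows_def)

lemma growsD:
  assumes "grows E S X" "S \<subseteq> Y" "Y \<subset> X"
  shows "\<exists>y\<in>Y. \<exists>z\<in>X - Y. (y, z) \<in> E"
  using assms by (simp add: grows_def)

lemma grows_subset: "grows E S X \<Longrightarrow> S \<subseteq> X"
  by (simp add: grows_def)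

lemma grows_refl [simp]: "grows E X X"
  by (auto simp: grows_def)

lemma grows_mono: "grows E S X \<Longrightarrow> S \<subseteq> T \<Longrightarrow> T \<subseteq> X \<Longrightarrow> grows E T X"
  by (simp add: grows_def subset_trans)

lemma grows_mono_rel:
  assumes "grows E S X" "E \<inter> X \<times> X \<subseteq> E'"
  shows "grows E' S X"
proof (rule growsI)
  show "S \<subseteq> X" using assms(1) by (rule grows_subset)
  fix Y assume "S \<subseteq> Y" "Y \<subset> X"
  then show "\<exists>y\<in>Y. \<exists>z\<in>X - Y. (y, z) \<in> E'" using growsD[OF assms(1), of Y] assms(2) by blast
qed

lemma linked_mono_rel: "linked E X \<Longrightarrow> E \<inter> X \<times> X \<subseteq> E' \<Longrightarrow> linked E' X"
  by (simp add: linked_def grows_mono_rel[of E _ X E'])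

text \<open>A cut containing \<open>u\<close> is crossed because the larger root grows; a cut
  missing \<open>u\<close> is crossed by the arc from \<open>s\<close> to \<open>u\<close> itself.
  This lets inductions absorb neighbours into the root one at a time.\<close>

lemma grows_insert:
  assumes "grows E (insert u S) X" "s \<in> S" "(s, u) \<in> E"
  shows "grows E S X"
proof (rule growsI)
  show "S \<subseteq> X" using grows_subset[OF assms(1)] by auto
  fix Y assume Y: "S \<subseteq> Y" "Y \<subset> X"
  show "\<exists>y\<in>Y. \<exists>z\<in>X - Y. (y, z) \<in> E"
  proof (cases "u \<in> Y")
    case True
    then show ?thesis using Y growsD[OF assms(1), of Y] by blast
  next
    case False
    then show ?thesis using Y assms grows_subset[OF assms(1)] by blast
  qed
qed

text \<open>A proper subset of the union fails to contain one of the two sets, and its trace on that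
  set is a cut there.\<close>

lemma grows_Un:
  assumes "grows E S X" "grows E S Z"
  shows "grows E S (X \<union> Z)"
proof (rule growsI)
  show "S \<subseteq> X \<union> Z" using grows_subset[OF assms(1)] by auto
  fix Y assume Y: "S \<subseteq> Y" "Y \<subset> X \<union> Z"
  have *: "\<exists>y\<in>Y. \<exists>z\<in>X \<union> Z - Y. (y, z) \<in> E" if "grows E S W" "W \<subseteq> X \<union> Z" "\<not> W \<subseteq> Y" for W
  proof -
    have "S \<subseteq> Y \<inter> W" "Y \<inter> W \<subset> W" using that Y grows_subset[OF that(1)] by auto
    from growsD[OF that(1) this] show ?thesis using that by blast
  qed
  show "\<exists>y\<in>Y. \<exists>z\<in>X \<union> Z - Y. (y, z) \<in> E"
    using *[OF assms(1)] *[OF assms(2)] Y by blast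
qed

text \<open>Cuts suit the inductions, whereas walks inside \<open>X\<close> can be reversed and
  concatenated and agree with the library's reachability. Forwards, the vertices reached from
  \<open>S\<close> would form an uncrossed cut; backwards, a walk that never leaves \<open>Y\<close>
  cannot reach \<open>x\<close>.\<close>

lemma grows_iff_rtrancl_on:
  "grows E S X \<longleftrightarrow> S \<subseteq> X \<and> (\<forall>x\<in>X. \<exists>s\<in>S. (s, x) \<in> rtrancl_on X E)"
proof
  assume g: "grows E S X"
  define Y where "Y = {x \<in> X. \<exists>s\<in>S. (s, x) \<in> rtrancl_on X E}"
  have "S \<subseteq> Y" using grows_subset[OF g] by (auto simp: Y_def)
  have "Y = X"
  proof (rule ccontr)
    assume "Y \<noteq> X"
    then have "Y \<subset> X" by (auto simp: Y_def)
    from growsD[OF g \<open>S \<subseteq> Y\<close> this] obtain y z where "y \<in> Y" "z \<in> X" "z \<notin> Y" "(y, z) \<in> E" by blast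
    then show False unfolding Y_def by (auto intro: rtrancl_on_into_rtrancl_on)
  qed
  then show "S \<subseteq> X \<and> (\<forall>x\<in>X. \<exists>s\<in>S. (s, x) \<in> rtrancl_on X E)"
    using grows_subset[OF g] by (auto simp: Y_def)
next
  assume r: "S \<subseteq> X \<and> (\<forall>x\<in>X. \<exists>s\<in>S. (s, x) \<in> rtrancl_on X E)"
  show "grows E S X"
  proof (rule growsI)
    show "S \<subseteq> X" using r by blast
    fix Y assume Y: "S \<subseteq> Y" "Y \<subset> X"
    then obtain x where x: "x \<in> X" "x \<notin> Y" by blast
    then obtain s where s: "s \<in> S" "(s, x) \<in> rtrancl_on X E" using r by blast
    show "\<exists>y\<in>Y. \<exists>z\<in>X - Y. (y, z) \<in> E"
    proof (rule ccontr)
      assume no: "\<not> ?thesis"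
      from s(2) have "x \<in> Y"
        by (induction rule: rtrancl_on_induct) (use s(1) Y no in blast)+
      with x show False by blast
    qed
  qed
qed

lemma linked_iff_rtrancl_on:
  "linked E X \<longleftrightarrow> X \<noteq> {} \<and> (\<forall>x\<in>X. \<forall>y\<in>X. (x, y) \<in> rtrancl_on X E)"
  unfolding linked_def grows_iff_rtrancl_on by auto

text \<open>Symmetry allows walking from any vertex back to the root and on to any other
  vertex.\<close>

lemma grows_imp_linked:
  assumes "sym E" "grows E {x} X"
  shows "linked E X"
proof -
  have x: "x \<in> X" and r: "\<And>y. y \<in> X \<Longrightarrow> (x, y) \<in> rtrancl_on X E"
    using assms(2) by (auto simp: grows_iff_rtrancl_on)
  have "(y, z) \<in> rtrancl_on X E" if "y \<in> X" "z \<in> X" for y z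
    using rtrancl_on_trans[OF symD[OF rtrancl_on_sym[OF assms(1)] r[OF that(1)]] r[OF that(2)]] .
  then show ?thesis using x by (auto simp: linked_iff_rtrancl_on)
qed

lemma linkedD:
  assumes "linked E X" "Y \<subset> X" "Y \<noteq> {}"
  shows "\<exists>y\<in>Y. \<exists>z\<in>X - Y. (y, z) \<in> E"
proof -
  from assms obtain x where "x \<in> Y" by blast
  then have "grows E {x} X" using assms by (auto simp: linked_def)
  from growsD[OF this _ assms(2)] \<open>x \<in> Y\<close> show ?thesis by blast
qed

lemma linked_singleton [simp]: "linked E {x}"
  by (simp add: linked_def)

lemma linked_insert:
  assumes "sym E" "linked E X" "x \<in> X" "(x, p) \<in> E"
  shows "linked E (insert p X)"
proof -
  have "grows E {x} (insert p {x})"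
    by (rule grows_insert[of _ p]) (use assms in auto)
  moreover have "grows E {x} X" using assms by (simp add: linked_def)
  ultimately have "grows E {x} (insert p {x} \<union> X)" by (rule grows_Un)
  moreover have "insert p {x} \<union> X = insert p X" using assms by auto
  ultimately show ?thesis using grows_imp_linked[OF assms(1)] by simp
qed

section \<open>Counting connected vertex sets\<close>

lemma obtain_neighbour:
  assumes "grows E S X" "S \<noteq> X"
  obtains s u where "s \<in> S" "u \<in> X" "u \<notin> S" "(s, u) \<in> E"
  using growsD[OF assms(1), of S] assms grows_subset[OF assms(1)] by blast

lemma card_Diff_insert_Suc:
  assumes "finite X" "u \<in> X" "u \<notin> S"
  shows "card (X - S) = Suc (card (X - insert u S))"
  unfolding Diff_insert[of X u S] by (rule card_Suc_Diff1[symmetric]) (use assms in auto)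

text \<open>Absorbing one neighbour after another yields a chain of grown sets from \<open>S\<close>
  up to \<open>X\<close>. In the induction, \<open>S\<close> itself is the one additional set
  compared with the root \<open>insert u S\<close>.\<close>

lemma card_grows_ge_chain:
  assumes "finite X" "grows E S X"
  shows "Suc (card (X - S)) \<le> card {Z. Z \<subseteq> X \<and> grows E S Z}"
  using assms
proof (induction "card (X - S)" arbitrary: S)
  case 0
  then have "X = S" using grows_subset[of E S X] by auto
  then have "card {S} \<le> card {Z. Z \<subseteq> X \<and> grows E S Z}"
    using 0 by (intro card_mono) auto
  then show ?case using \<open>X = S\<close> by simp
next
  case (Suc k)
  then have "S \<noteq> X" by auto
  then obtain s u where u: "s \<in> S" "u \<in> X" "u \<notin> S" "(s, u) \<in> E"
    using obtain_neighbour Suc.prems by metis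
  have g: "grows E (insert u S) X"
    using grows_mono[OF Suc.prems(2), of "insert u S"] u grows_subset[OF Suc.prems(2)] by blast
  have k: "k = card (X - insert u S)"
    using card_Diff_insert_Suc[of X u S] Suc.hyps(2) Suc.prems u by simp
  let ?A = "{Z. Z \<subseteq> X \<and> grows E (insert u S) Z}"
  have fin: "finite {Z. Z \<subseteq> X \<and> P Z}" for P using Suc.prems(1) by simp
  have "S \<notin> ?A" using u grows_subset[of E "insert u S" S] by auto
  then have "Suc (card ?A) = card (insert S ?A)" using fin by simp
  also have "\<dots> \<le> card {Z. Z \<subseteq> X \<and> grows E S Z}"
    by (rule card_mono[OF fin]) (use grows_insert[OF _ u(1,4)] grows_subset[OF Suc.prems(2)] in auto)
  finally show ?case using Suc.hyps(1)[OF k Suc.prems(1) g] k Suc.hyps(2) by simp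
qed

text \<open>
  Split by a neighbour \<open>u\<close> of the root: \<open>X - {u}\<close> still grows from the root, so a chain
  provides the sets avoiding \<open>u\<close>; the sets containing \<open>u\<close> are counted with \<open>u\<close> moved into the root.
\<close>

lemma card_grows_ge:
  assumes "finite X" "grows E S X" "\<And>x. x \<in> X - S \<Longrightarrow> grows E S (X - {x})"
  shows "card (X - S) * (card (X - S) + 1) + 2 \<le> 2 * card {Z. Z \<subseteq> X \<and> grows E S Z}"
  using assms
proof (induction "card (X - S)" arbitrary: S)
  case 0
  show ?case using card_grows_ge_chain[OF 0(2,3)] unfolding 0(1)[symmetric] by simp
next
  case (Suc k)
  then have "S \<noteq> X" by auto
  then obtain s u where u: "s \<in> S" "u \<in> X" "u \<notin> S" "(s, u) \<in> E"
    using obtain_neighbour Suc.prems by metis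
  have SX: "S \<subseteq> X" using grows_subset[OF Suc.prems(2)] .
  have g: "grows E (insert u S) X"
    using grows_mono[OF Suc.prems(2), of "insert u S"] u SX by blast
  have g': "grows E (insert u S) (X - {x})" if "x \<in> X - insert u S" for x
    by (rule grows_mono[OF Suc.prems(3)[of x]]) (use that SX u in auto)
  have k: "k = card (X - insert u S)"
    using card_Diff_insert_Suc[of X u S] Suc.hyps(2) Suc.prems u by simp
  have IH: "k * (k + 1) + 2 \<le> 2 * card {Z. Z \<subseteq> X \<and> grows E (insert u S) Z}"
    using Suc.hyps(1)[OF k Suc.prems(1) g g'] k by simp
  have "X - {u} - S = X - insert u S" by auto
  then have chain: "Suc k \<le> card {Z. Z \<subseteq> X - {u} \<and> grows E S Z}"
    using card_grows_ge_chain[of "X - {u}" E S] Suc.prems(1) Suc.prems(3)[of u] u k by simp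
  let ?A = "{Z. Z \<subseteq> X \<and> grows E (insert u S) Z}"
  let ?B = "{Z. Z \<subseteq> X - {u} \<and> grows E S Z}"
  have fin: "finite {Z. Z \<subseteq> X \<and> P Z}" "finite {Z. Z \<subseteq> X - {u} \<and> P Z}" for P
    using Suc.prems(1) by simp_all
  have "?A \<inter> ?B = {}" using grows_subset by fastforce
  then have "card ?A + card ?B = card (?A \<union> ?B)" using fin by (subst card_Un_disjoint) auto
  also have "\<dots> \<le> card {Z. Z \<subseteq> X \<and> grows E S Z}"
    by (rule card_mono[OF fin(1)]) (use grows_insert[OF _ u(1,4)] in auto)
  finally have le: "card ?A + card ?B \<le> card {Z. Z \<subseteq> X \<and> grows E S Z}" .
  \<comment> \<open>The counts add up by
    \<open>(k * (k + 1) + 2) + 2 * (k + 1) = (k + 1) * (k + 2) + 2\<close>.\<close>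
  show ?case using IH chain le unfolding Suc.hyps(2)[symmetric] by simp
qed

text \<open>The vertex absorbed last into the growing root can be removed; it plays the role of a
  leaf of a spanning tree.\<close>

lemma obtain_removable:
  assumes "finite X" "grows E S X" "S \<noteq> X"
  obtains u where "u \<in> X - S" "grows E S (X - {u})"
  using assms
proof (induction "card (X - S)" arbitrary: S thesis)
  case 0
  then show ?case using grows_subset[of E S X] by auto
next
  case (Suc k)
  then obtain s u where u: "s \<in> S" "u \<in> X" "u \<notin> S" "(s, u) \<in> E"
    using obtain_neighbour by metis
  have SX: "S \<subseteq> X" using grows_subset[OF Suc.prems(3)] .
  show ?case
  proof (cases "insert u S = X")
    case True
    then show ?thesis using Suc.prems(1)[of u] u by auto
  next
    case False
    have g: "grows E (insert u S) X"
      using grows_mono[OF Suc.prems(3), of "insert u S"] u SX by blast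
    have k: "k = card (X - insert u S)"
      using card_Diff_insert_Suc[of X u S] Suc.hyps(2) Suc.prems u by simp
    obtain w where "w \<in> X - insert u S" "grows E (insert u S) (X - {w})"
      using Suc.hyps(1)[OF k _ Suc.prems(2) g False] by blast
    then show ?thesis using Suc.prems(1)[of w] grows_insert[OF _ u(1,4)] by auto
  qed
qed

text \<open>Remove a vertex \<open>u\<close> whose deletion keeps \<open>X\<close> connected: the
  connected sets containing \<open>u\<close> include a chain of length \<open>card X\<close>, and
  those avoiding \<open>u\<close> are counted by induction.\<close>

lemma card_linked_ge:
  assumes "finite X" "sym E" "linked E X"
  shows "card X * (card X + 1) \<le> 2 * card {Z. Z \<subseteq> X \<and> linked E Z}"
  using assms
proof (induction "card X" arbitrary: X)
  case 0
  then show ?case by simp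
next
  case (Suc k)
  then obtain x where x: "x \<in> X" by (auto simp: linked_def)
  have gx: "grows E {x} X" using Suc.prems x by (auto simp: linked_def)
  have fin: "finite {Z. Z \<subseteq> Y \<and> P Z}" if "Y \<subseteq> X" for P Y
    using finite_subset[OF that Suc.prems(1)] by simp
  show ?case
  proof (cases "X = {x}")
    case True
    then have "card {X} \<le> card {Z. Z \<subseteq> X \<and> linked E Z}"
      by (intro card_mono fin) auto
    then show ?thesis using True by simp
  next
    case False
    then obtain u where u: "u \<in> X - {x}" "grows E {x} (X - {u})"
      using obtain_removable[OF Suc.prems(1) gx] by blast
    have k: "k = card (X - {u})" using u Suc by simp
    have IH: "k * (k + 1) \<le> 2 * card {Z. Z \<subseteq> X - {u} \<and> linked E Z}"
      using Suc.hyps(1)[OF k] Suc.prems grows_imp_linked[OF Suc.prems(2) u(2)] k by simp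
    have "grows E {u} X" using Suc.prems u by (auto simp: linked_def)
    then have chain: "Suc k \<le> card {Z. Z \<subseteq> X \<and> grows E {u} Z}"
      using card_grows_ge_chain[of X E "{u}"] Suc.prems(1) k by simp
    let ?A = "{Z. Z \<subseteq> X \<and> grows E {u} Z}"
    let ?B = "{Z. Z \<subseteq> X - {u} \<and> linked E Z}"
    have "?A \<inter> ?B = {}" using grows_subset by fastforce
    then have "card ?A + card ?B = card (?A \<union> ?B)" using fin[of X] fin[of "X - {u}"]
      by (subst card_Un_disjoint) auto
    also have "\<dots> \<le> card {Z. Z \<subseteq> X \<and> linked E Z}"
      by (rule card_mono[OF fin]) (use grows_imp_linked[OF Suc.prems(2)] in auto)
    finally have le: "card ?A + card ?B \<le> card {Z. Z \<subseteq> X \<and> linked E Z}" .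
    show ?thesis using IH chain le unfolding Suc.hyps(2)[symmetric] by simp
  qed
qed

section \<open>Connected subgraphs and cut vertices\<close>

lemma connected_iff_linked:
  assumes "pair_graph H"
  shows "Digraph_Component.connected (with_proj H) \<longleftrightarrow> linked (parcs H) (pverts H)"
proof -
  interpret pair_graph H by fact
  show ?thesis
    using reachable_mk_symmetric_eq[OF sym_arcs]
    by (simp add: connected_def strongly_connected_def linked_iff_rtrancl_on reachable_def)
qed

text \<open>The condition that \<open>w\<close> is not the only vertex is required because the empty
  set is not \<open>linked\<close>, although the vertex of a one-vertex graph is no cut
  vertex.\<close>

lemma cut_vertex_iff:
  assumes "pair_graph G" "Digraph_Component.connected (with_proj G)"
  shows "cut_vertex G w \<longleftrightarrow> w \<in> pverts G \<and> pverts G \<noteq> {w} \<and> \<not> linked (parcs G) (pverts G - {w})"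
proof -
  interpret pair_graph G by fact
  have r: "x \<rightarrow>\<^sup>*\<^bsub>with_proj G\<^esub> y" if "x \<in> pverts G" "y \<in> pverts G" for x y
    using assms(2) that unfolding connected_iff_linked[OF assms(1)]
    by (simp add: linked_iff_rtrancl_on reachable_def)
  \<comment> \<open>Walks confined to the remaining vertices cannot use an arc at \<open>w\<close>,
    so deleting these arcs changes nothing.\<close>
  have d: "x \<rightarrow>\<^sup>*\<^bsub>pre_digraph.del_vert (with_proj G) w\<^esub> y \<longleftrightarrow> (x, y) \<in> rtrancl_on (pverts G - {w}) (parcs G)"
    for x y
  proof -
    have e: "arcs_ends (pre_digraph.del_vert (with_proj G) w) = {e \<in> parcs G. fst e \<noteq> w \<and> snd e \<noteq> w}"
      by (auto simp: arcs_ends_conv pre_digraph.del_vert_def)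
    have v: "verts (pre_digraph.del_vert (with_proj G) w) = pverts G - {w}"
      by (simp add: pre_digraph.del_vert_def)
    have "(x, y) \<in> rtrancl_on (pverts G - {w}) {e \<in> parcs G. fst e \<noteq> w \<and> snd e \<noteq> w}"
      if "(x, y) \<in> rtrancl_on (pverts G - {w}) (parcs G)"
      using that by (induction rule: rtrancl_on_induct) (auto intro: rtrancl_on_into_rtrancl_on)
    moreover have "(x, y) \<in> rtrancl_on (pverts G - {w}) (parcs G)"
      if "(x, y) \<in> rtrancl_on (pverts G - {w}) {e \<in> parcs G. fst e \<noteq> w \<and> snd e \<noteq> w}"
      using that by (induction rule: rtrancl_on_induct) (auto intro: rtrancl_on_into_rtrancl_on)
    ultimately show ?thesis unfolding reachable_def e v by blast
  qed
  show ?thesis unfolding cut_vertex_def d linked_iff_rtrancl_on using r by blast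
qed

lemma pair_graphI:
  assumes "finite X" "D \<subseteq> X \<times> X" "sym D" "irrefl D"
  shows "pair_graph \<lparr>pverts = X, parcs = D\<rparr>"
  using assms finite_subset[OF assms(2)]
  by unfold_locales (auto simp: symmetric_def irrefl_def)

lemma pair_graphD:
  assumes "pair_graph G"
  shows "finite (pverts G)" "parcs G \<subseteq> pverts G \<times> pverts G" "sym (parcs G)" "irrefl (parcs G)"
proof -
  interpret pair_graph G by fact
  show "finite (pverts G)" by (rule pair_finite_verts)
  show "parcs G \<subseteq> pverts G \<times> pverts G" using in_arcsD1 in_arcsD2 by auto
  show "sym (parcs G)" using arcs_symmetric by (auto intro: symI)
  show "irrefl (parcs G)" using no_loops' by (auto simp: irrefl_def)
qed

lemma finite_connected_subgraphs:
  assumes "pair_graph G"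
  shows "finite (connected_subgraphs G)"
proof (rule finite_imageD)
  have "finite (pverts G)" "finite (parcs G)"
    using pair_graphD[OF assms] finite_subset by fastforce+
  then show "finite ((\<lambda>H. (pverts H, parcs H)) ` connected_subgraphs G)"
    by (rule_tac finite_subset[of _ "Pow (pverts G) \<times> Pow (parcs G)"])
      (auto simp: connected_subgraphs_def subgraph_def)
  show "inj_on (\<lambda>H. (pverts H, parcs H)) (connected_subgraphs G)"
    by (auto intro!: inj_onI pair_pre_digraph.equality)
qed

text \<open>Reduces subgraphs to pairs of a vertex set and an arc set; finiteness and the absence of
  loops are inherited from \<open>G\<close>.\<close>

lemma in_connected_subgraphs_iff:
  assumes "pair_graph G"
  shows "\<lparr>pverts = X, parcs = D\<rparr> \<in> connected_subgraphs G \<longleftrightarrow>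
    X \<subseteq> pverts G \<and> D \<subseteq> parcs G \<and> D \<subseteq> X \<times> X \<and> sym D \<and> linked D X"
    (is "?H \<in> _ \<longleftrightarrow> ?R")
proof
  assume "?H \<in> connected_subgraphs G"
  then have "pair_graph ?H" "subgraph (with_proj ?H) (with_proj G)"
    and "Digraph_Component.connected (with_proj ?H)"
    by (auto simp: connected_subgraphs_def)
  then show ?R using pair_graphD[of ?H] connected_iff_linked[of ?H]
    by (auto simp: subgraph_def)
next
  assume R: ?R
  note G = pair_graphD[OF assms]
  have H: "pair_graph ?H"
    by (rule pair_graphI) (use R G finite_subset in \<open>auto simp: irrefl_def\<close>)
  interpret G: pair_graph G by fact
  interpret H: pair_graph ?H by fact
  have "subgraph (with_proj ?H) (with_proj G)"
    unfolding subgraph_def using R G.wf_digraph H.wf_digraph by (auto simp: compatible_def)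
  then show "?H \<in> connected_subgraphs G"
    using H R connected_iff_linked[OF H] by (auto simp: connected_subgraphs_def)
qed


section \<open>The lollipop\<close>

text \<open>For a periodic \<open>c\<close>, the index set \<open>UNIV\<close> gives a cycle and a
  short interval gives a path on it, also when the path passes the starting vertex
  \<open>c 0\<close>.\<close>

definition path_arcs :: "(nat \<Rightarrow> 'a) \<Rightarrow> nat set \<Rightarrow> 'a rel" where
  "path_arcs c I = (\<lambda>i. (c i, c (Suc i))) ` I \<union> (\<lambda>i. (c (Suc i), c i)) ` I"

definition lollipop_graph :: "(nat \<Rightarrow> 'a) \<Rightarrow> 'a \<Rightarrow> 'a pair_pre_digraph" where
  "lollipop_graph c p =
     \<lparr>pverts = insert p (range c), parcs = path_arcs c UNIV \<union> {(c 0, p), (p, c 0)}\<rparr>"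

lemma sym_path_arcs: "sym (path_arcs c I)"
  by (auto simp: path_arcs_def sym_def)

lemma linked_path_arcs:
  assumes "0 < k"
  shows "linked (path_arcs c UNIV) (c ` {s..<s + k})"
  using assms
proof (induction k rule: nat_induct_non_zero)
  case 1
  then show ?case by simp
next
  case (Suc k)
  have "linked (path_arcs c UNIV) (insert (c (s + k)) (c ` {s..<s + k}))"
    by (rule linked_insert[OF sym_path_arcs Suc.IH, of "c (s + k - 1)"])
      (use Suc.hyps in \<open>auto simp: path_arcs_def image_iff intro!: exI[of _ "s + k - 1"]\<close>)
  moreover have "{s..<s + Suc k} = insert (s + k) {s..<s + k}" by auto
  ultimately show ?case by simp
qed

text \<open>Here \<open>m\<close> is the length of the cycle, so the graph has \<open>m + 1\<close>
  vertices. The periodic indexing turns every path on the cycle into an interval of indices without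
  wrap-around cases.\<close>

locale lollipop =
  fixes m :: nat and c :: "nat \<Rightarrow> 'a" and p :: 'a
  assumes m: "3 \<le> m" and periodic: "\<And>i. c (i + m) = c i"
    and inj: "inj_on c {..<m}" and p: "p \<notin> range c"
begin

section \<open>Cycle vertices and indices modulo the cycle length\<close>

lemma c_mod: "c (i mod m) = c i"
proof -
  have "c (j + t * m) = c j" for j t
    by (induction t) (use periodic[of "j + _ * m"] in \<open>auto simp: algebra_simps\<close>)
  from this[of "i mod m" "i div m"] show ?thesis by simp
qed

lemma c_eq_iff: "c i = c j \<longleftrightarrow> i mod m = j mod m"
proof
  assume "c i = c j"
  then have "c (i mod m) = c (j mod m)" by (simp add: c_mod)
  then show "i mod m = j mod m" using m by (intro inj_onD[OF inj]) auto
qed (metis c_mod)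

lemma c_neq: "i < j \<Longrightarrow> j < i + m \<Longrightarrow> c i \<noteq> c j"
  unfolding c_eq_iff by (metis add_diff_inverse_nat mod_eq_dvd_iff_nat nat_dvd_not_less
      nat_add_left_cancel_less less_imp_le not_less zero_less_diff)

lemma c_Suc_cong: "c i = c j \<Longrightarrow> c (Suc i) = c (Suc j)"
  unfolding c_eq_iff by (metis mod_Suc_eq)

lemma c_pred_cong: "c (Suc i) = c (Suc j) \<Longrightarrow> c i = c j"
proof -
  assume "c (Suc i) = c (Suc j)"
  then have "(Suc i + (m - 1)) mod m = (Suc j + (m - 1)) mod m"
    unfolding c_eq_iff by (metis mod_add_left_eq)
  then show ?thesis using m by (simp add: c_eq_iff)
qed

lemma range_c: "range c = c ` {s..<s + m}"
proof
  show "range c \<subseteq> c ` {s..<s + m}"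
  proof
    fix x assume "x \<in> range c"
    then obtain j where j: "x = c j" by blast
    \<comment> \<open>This is the index in the window congruent to \<open>j\<close>; adding
      \<open>m * s\<close> keeps the natural subtraction exact.\<close>
    define i where "i = s + (j + m * s - s) mod m"
    have "s + (j + m * s - s) = j + m * s" using m by (cases m) auto
    then have "i mod m = (j + m * s) mod m" unfolding i_def by (simp only: mod_add_right_eq)
    then have "x = c i" using j by (simp add: c_eq_iff)
    moreover have "i \<in> {s..<s + m}" using m unfolding i_def by auto
    ultimately show "x \<in> c ` {s..<s + m}" by blast
  qed
qed auto

lemma inj_on_window: "inj_on c {s..<s + m}"
proof (rule inj_onI)
  fix i j assume "i \<in> {s..<s + m}" "j \<in> {s..<s + m}" "c i = c j"
  then show "i = j" using c_neq[of i j] c_neq[of j i] by (cases i j rule: linorder_cases) auto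
qed

lemma finite_range: "finite (range c)"
  by (subst range_c[of 0]) simp

lemma card_range: "card (range c) = m"
  by (subst range_c[of 0]) (use card_image[OF inj_on_window[of 0]] in simp)

text \<open>
  A connected subgraph other than the whole cycle has a vertex \<open>c s\<close> whose incoming cycle edge
  is missing; following the cycle from there up to the first missing edge exhausts the subgraph.
\<close>

lemma connected_subgraph_cycle_cases:
  assumes X: "X \<noteq> {}" "X \<subseteq> range c" and D: "D \<subseteq> path_arcs c UNIV" "D \<subseteq> X \<times> X" "sym D" "linked D X"
  shows "X = range c \<and> D = path_arcs c UNIV \<or>
    (\<exists>s k. s < m \<and> 1 \<le> k \<and> k \<le> m \<and> X = c ` {s..<s + k} \<and> D = path_arcs c {s..<s + k - 1})"
proof (cases "\<forall>i. c (Suc i) \<in> X \<longrightarrow> (c i, c (Suc i)) \<in> D")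
  case True
  obtain j where j: "c j \<in> X" using X by blast
  \<comment> \<open>In this case \<open>X\<close> is closed under predecessors on the cycle, so
    going backwards from a copy of \<open>j\<close> at or beyond \<open>i\<close> reaches every
    vertex.\<close>
  have down: "c (i + t) \<in> X \<Longrightarrow> c i \<in> X" for i t
    by (induction t) (use True D(2) in auto)
  have all: "c i \<in> X" for i
  proof (rule down)
    have "i + (j + m * i - i) = j + m * i" using m by (cases m) auto
    then have "(i + (j + m * i - i)) mod m = j mod m" by simp
    then show "c (i + (j + m * i - i)) \<in> X" using j c_eq_iff by metis
  qed
  then have "path_arcs c UNIV \<subseteq> D" using True D(3) by (auto simp: path_arcs_def dest: symD)
  then show ?thesis using all X D by auto
next
  case False
  then obtain i where i: "c (Suc i) \<in> X" "(c i, c (Suc i)) \<notin> D" by blast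
  define s where "s = Suc i mod m"
  define e where "e j \<longleftrightarrow> (c j, c (Suc j)) \<in> D" for j
  have e_cong: "e j \<longleftrightarrow> e j'" if "c j = c j'" for j j'
    unfolding e_def using that c_Suc_cong[OF that] by simp
  have s: "s < m" "c s \<in> X" using m i by (auto simp: s_def c_mod)
  have "c (Suc (s + m - 1)) = c (Suc i)" using m by (simp add: periodic) (simp add: s_def c_mod)
  then have ends: "c (s + m - 1) = c i" by (rule c_pred_cong)
  then have e_end: "\<not> e (s + m - 1)" using i e_cong[OF ends] by (simp add: e_def)
  \<comment> \<open>\<open>k\<close> counts the vertices from \<open>c s\<close> up to the first
    missing edge. The edge entering \<open>c s\<close> is missing, which bounds \<open>k\<close> by
    \<open>m\<close>.\<close>
  define k where "k = (LEAST k. 0 < k \<and> \<not> e (s + k - 1))"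
  have k: "0 < k" "\<not> e (s + k - 1)" "k \<le> m"
    using LeastI[of "\<lambda>k. 0 < k \<and> \<not> e (s + k - 1)" m] e_end m
      Least_le[of "\<lambda>k. 0 < k \<and> \<not> e (s + k - 1)" m] unfolding k_def by auto
  have e_k: "e (s + t)" if "Suc t < k" for t
    using not_less_Least[of "Suc t" "\<lambda>k. 0 < k \<and> \<not> e (s + k - 1)"] that unfolding k_def by auto
  define Y where "Y = c ` {s..<s + k}"
  have "c (s + t) \<in> X" if "t < k" for t
  proof (cases t)
    case 0
    then show ?thesis using s by simp
  next
    case (Suc t')
    then show ?thesis using e_k[of t'] that D(2) unfolding e_def by auto
  qed
  then have YX: "Y \<subseteq> X" unfolding Y_def
    by (metis (no_types, lifting) add_diff_inverse_nat atLeastLessThan_iff image_subsetI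
        nat_add_left_cancel_less not_less)
  have e_Y: "i' + 1 < s + k" if "e i'" "s \<le> i'" "i' < s + k" for i'
    using that k(2) by (cases "i' = s + k - 1") auto
  \<comment> \<open>An arc of \<open>D\<close> leaving \<open>Y\<close> would have to be the missing
    edge after the last vertex of \<open>Y\<close> or the missing edge before
    \<open>c s\<close>.\<close>
  have "Y = X"
  proof (rule ccontr)
    assume "Y \<noteq> X"
    moreover have "c s \<in> Y" using k by (auto simp: Y_def)
    ultimately obtain y z where yz: "y \<in> Y" "z \<in> X - Y" "(y, z) \<in> D"
      using linkedD[OF D(4), of Y] YX by blast
    from yz(1) obtain i' where i': "y = c i'" "s \<le> i'" "i' < s + k" by (auto simp: Y_def)
    from yz(3) D(1) consider j where "y = c j" "z = c (Suc j)" | j where "y = c (Suc j)" "z = c j"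
      by (auto simp: path_arcs_def)
    then show False
    proof cases
      case 1
      then have "z = c (Suc i')" using i' c_Suc_cong by metis
      moreover from this have "e i'" using yz i' by (simp add: e_def)
      ultimately show False using e_Y[of i'] i' yz unfolding Y_def by auto
    next
      case 2
      have ej: "e j" using yz(3) D(3) 2 by (auto simp: e_def dest: symD)
      show False
      proof (cases "i' = s")
        case True
        then have "c (Suc j) = c (Suc (s + m - 1))" using 2 i' m by (simp add: periodic)
        then show False using e_cong[OF c_pred_cong] ej e_end by blast
      next
        case False
        then have "c (Suc j) = c (Suc (i' - 1))" using 2 i' by simp
        then have "z = c (i' - 1)" using c_pred_cong 2 by metis
        moreover have "i' - 1 \<in> {s..<s + k}" using i' False by auto
        ultimately show False using yz unfolding Y_def by blast
      qed
    qed
  qed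
  have fwd: "(c j, c (Suc j)) \<in> path_arcs c {s..<s + k - 1}" if "e j" for j
  proof -
    have "c j \<in> Y" using that D(2) \<open>Y = X\<close> by (auto simp: e_def)
    then obtain i' where i': "c j = c i'" "s \<le> i'" "i' < s + k" by (auto simp: Y_def)
    then have "i' + 1 < s + k" using e_Y[of i'] e_cong[OF i'(1)] that by simp
    then show ?thesis using i' c_Suc_cong[OF i'(1)] by (auto simp: path_arcs_def)
  qed
  have "D = path_arcs c {s..<s + k - 1}"
  proof
    show "D \<subseteq> path_arcs c {s..<s + k - 1}"
    proof
      fix a assume a: "a \<in> D"
      with D(1) consider j where "a = (c j, c (Suc j))" | j where "a = (c (Suc j), c j)"
        by (auto simp: path_arcs_def)
      then show "a \<in> path_arcs c {s..<s + k - 1}"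
      proof cases
        case (1 j)
        then show ?thesis using a fwd[of j] by (simp add: e_def)
      next
        case (2 j)
        then have "e j" using a symD[OF D(3)] by (simp add: e_def)
        from symD[OF sym_path_arcs fwd[OF this]] show ?thesis using 2 by simp
      qed
    qed
    have "e j" if "j \<in> {s..<s + k - 1}" for j
      using e_k[of "j - s"] that by auto
    then show "path_arcs c {s..<s + k - 1} \<subseteq> D"
      using symD[OF D(3)] by (auto simp: path_arcs_def e_def)
  qed
  then show ?thesis using s k \<open>Y = X\<close> unfolding Y_def by (metis One_nat_def Suc_leI)
qed

section \<open>Membership of the lollipop in the class\<close>

abbreviation "stick \<equiv> {(c 0, p), (p, c 0)}"

lemma sym_arcs_lollipop: "sym (parcs (lollipop_graph c p))"
  using sym_path_arcs[of c UNIV] by (auto simp: lollipop_graph_def sym_def)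

lemma path_arcs_range: "(x, y) \<in> path_arcs c I \<Longrightarrow> x \<in> range c \<and> y \<in> range c"
  by (auto simp: path_arcs_def)

lemma pair_graph_lollipop: "pair_graph (lollipop_graph c p)"
  unfolding lollipop_graph_def
proof (rule pair_graphI)
  show "sym (path_arcs c UNIV \<union> stick)" using sym_arcs_lollipop by (simp add: lollipop_graph_def)
  have "c i \<noteq> c (Suc i)" "c (Suc i) \<noteq> c i" for i using c_neq[of i "Suc i"] m by auto
  moreover have "c 0 \<noteq> p" using p by auto
  ultimately show "irrefl (path_arcs c UNIV \<union> stick)"
    by (auto simp: irrefl_def path_arcs_def)
qed (use finite_range path_arcs_range in auto)

lemma linked_range: "linked (path_arcs c UNIV) (range c)"
  using linked_path_arcs[of m c 0] m range_c[of 0] by simp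

lemma connected_lollipop: "Digraph_Component.connected (with_proj (lollipop_graph c p))"
  unfolding connected_iff_linked[OF pair_graph_lollipop]
  using linked_insert[OF sym_arcs_lollipop linked_mono_rel[OF linked_range], of "c 0" p]
  by (auto simp: lollipop_graph_def)

lemma card_verts_lollipop: "card (pverts (lollipop_graph c p)) = Suc m"
  using finite_range card_range p by (simp add: lollipop_graph_def)

text \<open>Deleting \<open>c 0\<close> isolates \<open>p\<close>, deleting \<open>p\<close> leaves
  the cycle, and deleting any other \<open>c i\<close> leaves a path through \<open>c 0\<close> with
  \<open>p\<close> still attached.\<close>

lemma cut_vertex_lollipop_iff: "cut_vertex (lollipop_graph c p) v \<longleftrightarrow> v = c 0"
proof -
  let ?E = "parcs (lollipop_graph c p)" and ?V = "pverts (lollipop_graph c p)"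
  have V: "?V = insert p (range c)" by (simp add: lollipop_graph_def)
  have path: "path_arcs c UNIV \<subseteq> ?E" by (auto simp: lollipop_graph_def)
  have "c 1 \<noteq> c 0" using c_neq[of 0 1] m by auto
  have "\<not> linked ?E (?V - {c 0})"
  proof
    assume "linked ?E (?V - {c 0})"
    moreover have "c 1 \<in> ?V - {c 0}" "c 1 \<noteq> p" "p \<in> ?V - {c 0}"
      using \<open>c 1 \<noteq> c 0\<close> p by (auto simp: V)
    ultimately obtain z where "z \<noteq> c 0" "(p, z) \<in> ?E"
      using linkedD[of ?E "?V - {c 0}" "{p}"] by blast
    then show False using p path_arcs_range[of p z UNIV] by (auto simp: lollipop_graph_def)
  qed
  moreover have "linked ?E (?V - {p})"
  proof -
    have "?V - {p} = range c" using p by (auto simp: V)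
    then show ?thesis using linked_mono_rel[OF linked_range] path by auto
  qed
  moreover have "linked ?E (?V - {c i})" if "c i \<noteq> c 0" for i
  proof -
    have eq: "range c - {c i} = c ` {Suc i..<Suc i + (m - 1)}"
    proof -
      have "{i..<i + m} = insert i {Suc i..<Suc i + (m - 1)}" using m by auto
      then have "range c = insert (c i) (c ` {Suc i..<Suc i + (m - 1)})" by (simp add: range_c[of i])
      moreover have "c i \<notin> c ` {Suc i..<Suc i + (m - 1)}" using c_neq[of i] m by (auto simp: image_iff)
      ultimately show ?thesis by auto
    qed
    have l: "linked ?E (range c - {c i})" unfolding eq
      by (rule linked_mono_rel[OF linked_path_arcs]) (use m path in auto)
    have "linked ?E (insert p (range c - {c i}))"
      by (rule linked_insert[OF sym_arcs_lollipop l, of "c 0"])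
        (use that in \<open>auto simp: lollipop_graph_def\<close>)
    moreover have "?V - {c i} = insert p (range c - {c i})" using p by (auto simp: V)
    ultimately show ?thesis by simp
  qed
  moreover have "?V \<noteq> {c 0}" using p by (auto simp: V)
  ultimately show ?thesis
    unfolding cut_vertex_iff[OF pair_graph_lollipop connected_lollipop] by (auto simp: V)
qed

lemma not_tree_lollipop: "\<not> undirected_tree (lollipop_graph c p)"
proof -
  let ?G = "lollipop_graph c p"
  let ?w = "\<lambda>s k. map (\<lambda>i. (c i, c (Suc i))) [s..<s + k]"
  have cas: "pcas (c s) (?w s k) (c (s + k))" for s k
  proof (induction k arbitrary: s)
    case (Suc k)
    have "[s..<s + Suc k] = s # [Suc s..<Suc s + k]" by (simp add: upt_conv_Cons)
    then show ?case using Suc[of "Suc s"] by simp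
  qed simp
  have verts: "pawalk_verts (c s) (?w s k) = map c [s..<Suc (s + k)]" for s k
  proof (induction k arbitrary: s)
    case (Suc k)
    have "[s..<s + Suc k] = s # [Suc s..<Suc s + k]" "[s..<Suc (s + Suc k)] = s # [Suc s..<Suc (Suc s + k)]"
      by (simp_all add: upt_conv_Cons del: upt_Suc)
    then show ?case using Suc[of "Suc s"] by (simp del: upt_Suc)
  qed simp
  have "c m = c 0" using periodic[of 0] by simp
  have "pre_digraph.awalk (with_proj ?G) (c 0) (?w 0 m) (c 0)"
    using cas[of 0 m] \<open>c m = c 0\<close>
    by (auto simp: pre_digraph.awalk_def cas_with_proj_eq lollipop_graph_def path_arcs_def)
  \<comment> \<open>Dropping the first of the two occurrences of \<open>c 0\<close> leaves the
    window of length \<open>m\<close> that starts at index 1.\<close>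
  moreover have "distinct (tl (map c [0..<Suc (0 + m)]))"
    using inj_on_window[of 1] by (simp add: map_tl[symmetric] tl_upt distinct_map del: upt_Suc)
  ultimately have "pre_digraph.cycle (with_proj ?G) (?w 0 m)"
    unfolding pre_digraph.cycle_def awalk_verts_with_proj_eq
    using m verts[of 0 m] by (intro exI[of _ "c 0"]) (auto simp del: upt_Suc)
  then show ?thesis using m unfolding undirected_tree_def by fastforce
qed

lemma Collect_cut_vertex_lollipop: "{v. cut_vertex (lollipop_graph c p) v} = {c 0}"
  by (simp add: cut_vertex_lollipop_iff)

lemma lollipop_in_class:
  "lollipop_graph c p \<in> non_tree_graphs_with_cut_vertices (Suc m) 1"
  by (simp add: non_tree_graphs_with_cut_vertices_def graphs_with_cut_vertices_def
      pair_graph_lollipop connected_lollipop card_verts_lollipop Collect_cut_vertex_lollipop not_tree_lollipop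
      del: Collect_const)

section \<open>Upper bound for the number of connected subgraphs of the lollipop\<close>

abbreviation "cycle_shape \<equiv> (range c, path_arcs c UNIV)"
text \<open>A path is coded by its first index \<open>s\<close> and its number \<open>k\<close> of
  vertices; it has \<open>k - 1\<close> edges.\<close>

abbreviation "path_shape \<equiv> \<lambda>(s, k). (c ` {s..<s + k}, path_arcs c {s..<s + k - 1})"
abbreviation "add_stick \<equiv> \<lambda>(X, D). (insert p X, D \<union> stick)"
abbreviation "path_indices \<equiv> {..<m} \<times> {1..m}"
text \<open>These are the paths through the vertex carrying the stick: since
  \<open>c 0 = c m\<close>, the window starts at 0 or contains the index \<open>m\<close>.\<close>

abbreviation "rooted_path_indices \<equiv> {(s, k). s < m \<and> 1 \<le> k \<and> k \<le> m \<and> (s = 0 \<or> m < s + k)}"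

text \<open>The leaf \<open>p\<close> is absent, alone, or attached to \<open>c 0\<close>; in the
  last case its removal leaves a connected subgraph of the cycle through \<open>c 0\<close>.\<close>

lemma connected_subgraph_lollipop_cases:
  assumes "\<lparr>pverts = X, parcs = D\<rparr> \<in> connected_subgraphs (lollipop_graph c p)"
  shows "(X, D) \<in> insert cycle_shape (path_shape ` path_indices) \<union> {({p}, {})} \<union>
    add_stick ` insert cycle_shape (path_shape ` rooted_path_indices)"
proof -
  have X: "X \<subseteq> insert p (range c)" and D: "D \<subseteq> path_arcs c UNIV \<union> stick" "D \<subseteq> X \<times> X" "sym D" "linked D X"
    using assms unfolding in_connected_subgraphs_iff[OF pair_graph_lollipop]
    by (auto simp: lollipop_graph_def)
  have arc_p: "z = c 0" if "(p, z) \<in> D" for z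
    using that D(1) p path_arcs_range[of p z UNIV] by auto
  show ?thesis
  proof (cases "p \<in> X")
    case False
    then have "X \<subseteq> range c" "D \<subseteq> path_arcs c UNIV" "X \<noteq> {}" using X D by (auto simp: linked_def)
    from connected_subgraph_cycle_cases[OF this(3,1,2) D(2-4)] show ?thesis
    proof
      assume "\<exists>s k. s < m \<and> 1 \<le> k \<and> k \<le> m \<and> X = c ` {s..<s + k} \<and> D = path_arcs c {s..<s + k - 1}"
      then obtain s k where "(s, k) \<in> path_indices" "(X, D) = path_shape (s, k)" by auto
      then show ?thesis by blast
    qed simp
  next
    case True
    show ?thesis
    proof (cases "X = {p}")
      case True
      have "(p, p) \<notin> D" using arc_p[of p] p by force
      then have "D = {}" using D(2) True by blast
      then show ?thesis using True by simp
    next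
      case False
      define X' where "X' = X - {p}"
      define D' where "D' = D \<inter> X' \<times> X'"
      obtain z where "z \<in> X" "z \<noteq> p" "(p, z) \<in> D"
        using linkedD[OF D(4), of "{p}"] True False by blast
      then have c0: "c 0 \<in> X'" "(p, c 0) \<in> D" "(c 0, p) \<in> D"
        using arc_p symD[OF D(3)] by (auto simp: X'_def)
      have "sym D'" using D(3) by (auto simp: D'_def sym_def)
      \<comment> \<open>Adding \<open>p\<close> to a cut creates no new exit, since the only
        neighbour of \<open>p\<close> is \<open>c 0\<close>, which already lies in the cut.\<close>
      have "grows D' {c 0} X'"
      proof (rule growsI)
        fix Y assume Y: "{c 0} \<subseteq> Y" "Y \<subset> X'"
        then have "insert p Y \<subset> X" using True by (auto simp: X'_def)
        then obtain y z where "y \<in> insert p Y" "z \<in> X - insert p Y" "(y, z) \<in> D"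
          using linkedD[OF D(4), of "insert p Y"] by blast
        then show "\<exists>y\<in>Y. \<exists>z\<in>X' - Y. (y, z) \<in> D'"
          using Y arc_p[of z] by (auto simp: X'_def D'_def)
      qed (use c0 in simp)
      then have l: "linked D' X'" by (rule grows_imp_linked[OF \<open>sym D'\<close>])
      have sub: "X' \<noteq> {}" "X' \<subseteq> range c" "D' \<subseteq> path_arcs c UNIV" "D' \<subseteq> X' \<times> X'"
        using c0 X D(1) by (auto simp: X'_def D'_def)
      have "D \<subseteq> D' \<union> stick"
      proof
        fix a assume a: "a \<in> D"
        show "a \<in> D' \<union> stick"
        proof (cases "a \<in> stick")
          case False
          then have "a \<in> range c \<times> range c" using a D(1) path_arcs_range[of "fst a" "snd a" UNIV]
            by (cases a) auto
          then show ?thesis using a D(2) p by (auto simp: D'_def X'_def)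
        qed blast
      qed
      then have eq: "(X, D) = add_stick (X', D')" using c0 True by (auto simp: X'_def D'_def)
      from connected_subgraph_cycle_cases[OF sub \<open>sym D'\<close> l]
      have "(X', D') \<in> insert cycle_shape (path_shape ` rooted_path_indices)"
      proof
        assume "\<exists>s k. s < m \<and> 1 \<le> k \<and> k \<le> m \<and> X' = c ` {s..<s + k} \<and> D' = path_arcs c {s..<s + k - 1}"
        then obtain s k where sk: "s < m" "1 \<le> k" "k \<le> m"
          and XD: "X' = c ` {s..<s + k}" "D' = path_arcs c {s..<s + k - 1}"
          by blast
        from c0(1) XD obtain i where i: "c 0 = c i" "s \<le> i" "i < s + k" by auto
        then have "s = 0 \<or> m < s + k" using c_neq[of 0 i] by (cases "i = 0") auto
        then have "(s, k) \<in> rooted_path_indices" "(X', D') = path_shape (s, k)" using sk XD by auto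
        then show ?thesis by blast
      qed simp
      then show ?thesis unfolding eq by blast
    qed
  qed
qed

text \<open>The start 0 admits \<open>m\<close> lengths and a start \<open>s > 0\<close> admits the
  \<open>s\<close> lengths from \<open>m - s + 1\<close> to \<open>m\<close>.\<close>

lemma card_rooted_path_indices: "2 * card rooted_path_indices = m * (m + 1)"
proof -
  have "rooted_path_indices = Sigma {..<m} (\<lambda>s. if s = 0 then {1..m} else {m - s + 1..m})"
    using m by (auto split: if_splits)
  then have "card rooted_path_indices = (\<Sum>s<m. card (if s = 0 then {1..m} else {m - s + 1..m}))"
    by simp
  also have "\<dots> = (\<Sum>s<m. (if s = 0 then m else 0) + s)"
    by (rule sum.cong) auto
  also have "\<dots> = m + (\<Sum>s<m. s)"
    using m by (simp add: sum.distrib)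
  finally have "2 * card rooted_path_indices = 2 * m + 2 * (\<Sum>s<m. s)" by simp
  moreover have "2 * (\<Sum>s<k. s) + k = k * k" for k :: nat by (induction k) auto
  from this[of m] have "2 * (\<Sum>s<m. s) + m = m * m" .
  ultimately show ?thesis by (simp add: algebra_simps)
qed

text \<open>There are at most \<open>m * m + 1\<close> subgraphs avoiding \<open>p\<close>, one
  consisting of \<open>p\<close>, and \<open>m * (m + 1) / 2 + 1\<close> joining \<open>p\<close> to
  the cycle. For an upper bound the codings only have to be exhaustive.\<close>

lemma F_lollipop_le: "2 * F (lollipop_graph c p) \<le> 3 * m * m + m + 6"
proof -
  let ?A = "insert cycle_shape (path_shape ` path_indices)"
  let ?B = "insert cycle_shape (path_shape ` rooted_path_indices)"
  have "finite rooted_path_indices"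
    by (rule finite_subset[of _ path_indices]) auto
  then have B: "finite ?B" "card ?B \<le> Suc (card rooted_path_indices)"
    by (simp_all add: card_insert_le_m1 card_image_le order.trans[OF card_insert_le_m1])
  have A: "finite ?A" "card ?A \<le> Suc (m * m)"
    using card_image_le[of path_indices path_shape] by (simp_all add: card_insert_if card_cartesian_product)
  have "connected_subgraphs (lollipop_graph c p) \<subseteq>
    (\<lambda>(X, D). \<lparr>pverts = X, parcs = D\<rparr>) ` (?A \<union> {({p}, {})} \<union> add_stick ` ?B)"
  proof
    fix H assume H: "H \<in> connected_subgraphs (lollipop_graph c p)"
    have eq: "\<lparr>pverts = pverts H, parcs = parcs H\<rparr> = H" by simp
    have "(pverts H, parcs H) \<in> ?A \<union> {({p}, {})} \<union> add_stick ` ?B"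
      by (rule connected_subgraph_lollipop_cases) (simp only: eq H)
    then show "H \<in> (\<lambda>(X, D). \<lparr>pverts = X, parcs = D\<rparr>) ` (?A \<union> {({p}, {})} \<union> add_stick ` ?B)"
      by (rule image_eqI[rotated]) simp
  qed
  then have "F (lollipop_graph c p) \<le> card (?A \<union> {({p}, {})} \<union> add_stick ` ?B)"
    unfolding F_def using A B by (intro surj_card_le) auto
  also have "\<dots> \<le> card ?A + 1 + card ?B"
    by (rule order.trans[OF card_Un_le add_mono[OF order.trans[OF card_Un_le] card_image_le]]) (use B in auto)
  finally show ?thesis using A(2) B(2) card_rooted_path_indices by (simp add: algebra_simps)
qed

text \<open>The isomorphism sends \<open>c i\<close> to \<open>i mod m\<close> and \<open>p\<close>
  to \<open>m\<close>.\<close>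

lemma lollipop_iso_L_graph: "digraph_iso (with_proj (lollipop_graph c p)) (with_proj (L_graph (Suc m)))"
proof -
  define g where "g x = (if x = p then m else the_inv_into {..<m} c x)" for x
  have g_c: "g (c i) = i mod m" for i
    using the_inv_into_f_f[OF inj, of "i mod m"] m p by (auto simp: g_def c_mod)
  have g_p: "g p = m" by (simp add: g_def)
  have rc: "range c = c ` {..<m}" using range_c[of 0] by (simp add: atLeast0LessThan)
  have img_c: "g ` range c = {..<m}"
    unfolding rc image_image by (rule order.antisym) (use m in \<open>auto simp: g_c image_iff\<close>)
  have "inj_on g (range c)" by (auto intro!: inj_onI simp: g_c c_eq_iff)
  moreover have "g p \<notin> g ` range c" using img_c g_p by simp
  ultimately have injg: "inj_on g (insert p (range c))" using p by simp
  have img: "g ` insert p (range c) = {..<Suc m}"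
    by (simp add: img_c g_p lessThan_Suc)
  have window: "path_arcs c UNIV = path_arcs c {..<m}"
  proof -
    have "\<exists>j<m. c i = c j \<and> c (Suc i) = c (Suc j)" for i
      using m c_mod[of i] c_Suc_cong[of i "i mod m"] by (intro exI[of _ "i mod m"]) auto
    then show ?thesis unfolding path_arcs_def by fastforce
  qed
  define C where "C = {(i, i + 1) | i. i + 1 < m} \<union> {(m - 1, 0)}"
  have img_path: "map_prod g g ` path_arcs c {..<m} = C \<union> C\<inverse>"
  proof -
    \<comment> \<open>The index \<open>m - 1\<close> is split off because its edge closes the cycle
      and becomes the separate pair \<open>(m - 1, 0)\<close>.\<close>
    have "{..<m} = insert (m - 1) {i. i + 1 < m}" using m by auto
    moreover have "g (c i) = i" if "i + 1 < m" for i using that by (simp add: g_c)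
    moreover have "g (c (Suc i)) = Suc i" if "i + 1 < m" for i using that by (simp add: g_c)
    moreover have "g (c (m - 1)) = m - 1" "g (c (Suc (m - 1))) = 0" using m by (simp_all add: g_c)
    ultimately show ?thesis
      unfolding path_arcs_def C_def by (simp add: image_Un image_image converse_Un) (auto simp: image_iff)
  qed
  have img_stick: "map_prod g g ` stick = {(0, m), (m, 0)}" using g_c[of 0] g_p by simp
  have "map_prod g g ` (path_arcs c UNIV \<union> stick) = (C \<union> C\<inverse>) \<union> {(0, m), (m, 0)}"
    unfolding image_Un window img_path img_stick ..
  also have "\<dots> = (C \<union> {(0, m)}) \<union> (C \<union> {(0, m)})\<inverse>" by (simp only: converse_Un) blast
  also have "\<dots> = parcs (L_graph (Suc m))"
    unfolding C_def L_graph_def Let_def by simp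
  finally have arcs: "map_prod g g ` (path_arcs c UNIV \<union> stick) = parcs (L_graph (Suc m))" .
  have L: "with_proj (L_graph (Suc m)) = app_iso \<lparr>iso_verts = g, iso_arcs = map_prod g g, iso_head = snd, iso_tail = fst\<rparr>
      (with_proj (lollipop_graph c p))"
    using arcs img by (simp add: app_iso_def with_proj_def lollipop_graph_def L_graph_def Let_def)
  interpret G: pair_graph "lollipop_graph c p" by (rule pair_graph_lollipop)
  have "parcs (lollipop_graph c p) \<subseteq> insert p (range c) \<times> insert p (range c)"
    using pair_graphD(2)[OF pair_graph_lollipop] by (simp add: lollipop_graph_def)
  then have "inj_on (map_prod g g) (parcs (lollipop_graph c p))"
    using map_prod_inj_on[OF injg injg] by (rule inj_on_subset[rotated])
  then have "pre_digraph.digraph_isomorphism (with_proj (lollipop_graph c p))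
      \<lparr>iso_verts = g, iso_arcs = map_prod g g, iso_head = snd, iso_tail = fst\<rparr>"
    using injg G.wf_digraph by (simp add: pre_digraph.digraph_isomorphism_def) (simp add: lollipop_graph_def)
  then show ?thesis unfolding digraph_iso_def using L by blast
qed

end


section \<open>Two-regular connected graphs\<close>

text \<open>Walk from \<open>v\<close> without ever turning back. The first repeated vertex is
  \<open>v\<close> itself, the walk is then periodic, and its vertices are closed under neighbours,
  so connectivity makes them all of \<open>V\<close>.\<close>

lemma two_regular_obtain_cycle:
  assumes fin: "finite V" and E: "E \<subseteq> V \<times> V" "sym E" "irrefl E"
    and lnk: "linked E V" and deg: "\<And>x. x \<in> V \<Longrightarrow> card (E `` {x}) = 2" and v: "v \<in> V"
  obtains c where "c 0 = v" "\<And>i. c (i + card V) = c i" "inj_on c {..<card V}" "range c = V"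
    "path_arcs c UNIV = E"
proof -
  define other where "other x y = (SOME z. (y, z) \<in> E \<and> z \<noteq> x)" for x y
  have nbrs: "E `` {y} = {x, other x y} \<and> other x y \<noteq> x" if "(x, y) \<in> E" for x y
  proof -
    have "card (E `` {y}) = 2" "x \<in> E `` {y}" using deg[of y] that E by (auto dest: symD)
    then obtain s t where st: "E `` {y} = {s, t}" "s \<noteq> t" "x = s \<or> x = t" by (auto simp: card_2_iff)
    then obtain z where z: "E `` {y} = {x, z}" "z \<noteq> x" by (metis insert_commute)
    then have "(y, z) \<in> E \<and> z \<noteq> x" by blast
    then have "(y, other x y) \<in> E \<and> other x y \<noteq> x" unfolding other_def by (rule someI)
    then show ?thesis using z by blast
  qed
  \<comment> \<open>The state of the walk is an arc, since the next vertex depends on the current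
    one and its predecessor.\<close>
  define nxt where "nxt = (\<lambda>(x, y). (y, other x y))"
  obtain w where w: "(v, w) \<in> E" using deg[OF v] by (auto simp: card_2_iff)
  define d where "d i = (nxt ^^ i) (v, w)" for i
  define c where "c i = fst (d i)" for i
  have d_Suc: "d (Suc i) = nxt (d i)" for i by (simp add: d_def)
  have d_in: "d i \<in> E" for i
  proof (induction i)
    case 0
    then show ?case using w by (simp add: d_def)
  next
    case (Suc i)
    then show ?case using nbrs[of "fst (d i)" "snd (d i)"] by (auto simp: d_Suc nxt_def split: prod.split)
  qed
  have d_c: "d i = (c i, c (Suc i))" for i
    by (cases "d i") (simp add: c_def d_Suc nxt_def)
  have arc: "(c i, c (Suc i)) \<in> E" for i using d_in[of i] d_c by simp
  have c_in: "c i \<in> V" for i using arc[of i] E by auto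
  have "c (Suc (Suc i)) = other (c i) (c (Suc i))" for i
    using d_Suc[of i] by (simp add: d_c nxt_def)
  then have nb: "E `` {c (Suc i)} = {c i, c (Suc (Suc i))}" "c (Suc (Suc i)) \<noteq> c i" for i
    using nbrs[OF arc[of i]] by auto
  have "\<not> inj_on c {..card V}"
  proof
    assume "inj_on c {..card V}"
    then have "card {..card V} \<le> card V" using c_in by (intro card_inj_on_le[OF _ _ fin]) auto
    then show False by simp
  qed
  then have ex: "\<exists>k. \<exists>j<k. c j = c k"
    unfolding inj_on_def by (metis linorder_neqE_nat)
  define k where "k = (LEAST k. \<exists>j<k. c j = c k)"
  obtain j where j: "j < k" "c j = c k"
    using LeastI_ex[OF ex] unfolding k_def by blast
  have inj_k: "inj_on c {..<k}"
  proof (rule inj_onI)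
    fix x y assume "x \<in> {..<k}" "y \<in> {..<k}" "c x = c y"
    then show "x = y"
      using not_less_Least[of x "\<lambda>k. \<exists>j<k. c j = c k"] not_less_Least[of y "\<lambda>k. \<exists>j<k. c j = c k"]
      unfolding k_def[symmetric] by (cases x y rule: linorder_cases) force+
  qed
  have neq: "c i \<noteq> c (Suc i)" for i using arc[of i] E(3) by (auto simp: irrefl_def)
  \<comment> \<open>A return after one step would be a loop, and a return after two steps would be a
    reversal.\<close>
  have j_far: "j + 3 \<le> k"
  proof -
    have "k \<noteq> Suc j" using neq[of j] j by auto
    moreover have "k \<noteq> Suc (Suc j)" using nb(2)[of j] j by auto
    ultimately show ?thesis using j by linarith
  qed
  obtain k' where k': "k = Suc k'" using j by (cases k) auto
  \<comment> \<open>A first repetition at a later vertex \<open>c j\<close> would make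
    \<open>c k'\<close> a third neighbour of it, besides its predecessor and successor on the
    walk.\<close>
  have j0: "j = 0"
  proof (rule ccontr)
    assume "j \<noteq> 0"
    then obtain j' where j': "j = Suc j'" by (cases j) auto
    have "c k' \<in> E `` {c j}" using arc[of k'] E(2) j k' by (auto dest: symD)
    then have "c k' = c j' \<or> c k' = c (Suc j)" using nb(1)[of j'] j' by auto
    then have "k' = j' \<or> k' = Suc j" 
      using inj_onD[OF inj_k, of k' j'] inj_onD[OF inj_k, of k' "Suc j"] j' j_far k' by auto
    then show False using j' j_far k' by auto
  qed
  \<comment> \<open>\<open>c 1\<close> is a neighbour of \<open>c k = c 0\<close> different from
    \<open>c k'\<close>, so the walk must continue to it; from here on the whole state
    repeats.\<close>
  have "c (Suc k) = c 1"
  proof -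
    have "c 1 \<in> E `` {c k}" using arc[of 0] j j0 by auto
    then have "c 1 = c k' \<or> c 1 = c (Suc k)" using nb(1)[of k'] k' by auto
    moreover have "c 1 \<noteq> c k'" using inj_onD[OF inj_k, of 1 k'] j_far k' j0 by auto
    ultimately show ?thesis by simp
  qed
  then have "d k = d 0" using j j0 by (simp add: d_c)
  then have per: "c (i + k) = c i" for i
    by (simp add: c_def d_def funpow_add)
  have nb': "E `` {c i} \<subseteq> range c" "y \<in> E `` {c i} \<Longrightarrow> (c i, y) \<in> path_arcs c UNIV" for i y
  proof -
    \<comment> \<open>Moving one period ahead gives even \<open>c 0\<close> a predecessor on the
      walk.\<close>
    have i: "c i = c (Suc (i + k'))" using per[of i] k' by simp
    then have n: "E `` {c i} = {c (i + k'), c (Suc (Suc (i + k')))}" using nb(1) by simp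
    then show "E `` {c i} \<subseteq> range c" by simp
    assume "y \<in> E `` {c i}"
    then show "(c i, y) \<in> path_arcs c UNIV" unfolding n unfolding i path_arcs_def by auto
  qed
  have range: "range c = V"
  proof (rule ccontr)
    assume "range c \<noteq> V"
    then have "range c \<subset> V" using c_in by auto
    then obtain y z where "y \<in> range c" "z \<in> V - range c" "(y, z) \<in> E" using linkedD[OF lnk, of "range c"] by blast
    then show False using nb'(1) by blast
  qed
  have "range c = c ` {..<k}"
  proof
    have "c i \<in> c ` {..<k}" for i
    proof (induction i rule: less_induct)
      case (less i)
      show ?case
      proof (cases "i < k")
        case False
        then show ?thesis using less[of "i - k"] per[of "i - k"] j by auto
      qed simp
    qed
    then show "range c \<subseteq> c ` {..<k}" by blast
  qed auto
  then have card: "card V = k" using range card_image[OF inj_k] by simp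
  have "E \<subseteq> path_arcs c UNIV"
  proof
    fix a assume a: "a \<in> E"
    then obtain i where "fst a = c i" using E(1) range by auto
    then show "a \<in> path_arcs c UNIV" using nb'(2)[of "snd a" i] a by (cases a) auto
  qed
  moreover have "path_arcs c UNIV \<subseteq> E" using arc symD[OF E(2) arc] by (auto simp: path_arcs_def)
  ultimately have arcs: "path_arcs c UNIV = E" by blast
  have "c 0 = v" by (simp add: c_def d_def)
  then show thesis using that[of c] per inj_k range arcs unfolding card by blast
qed

section \<open>Splitting a graph at a cut vertex\<close>

text \<open>Adding all of \<open>W \<inter> B\<close> to a cut on the side of \<open>A\<close> gives
  a cut of \<open>W\<close>. An arc leaving it ends in \<open>A\<close>, hence starts outside
  \<open>B\<close>, that is, in the original cut.\<close>

lemma grows_side: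
  assumes "linked E W" "v \<in> W" "W \<subseteq> insert v (A \<union> B)" "v \<notin> A" "A \<inter> B = {}"
    and no: "\<And>x y. (x, y) \<in> E \<Longrightarrow> x \<in> B \<Longrightarrow> y \<in> A \<Longrightarrow> False"
  shows "grows E {v} (W \<inter> insert v A)"
proof (rule growsI)
  fix Y assume Y: "{v} \<subseteq> Y" "Y \<subset> W \<inter> insert v A"
  let ?Y = "Y \<union> (W \<inter> B)"
  obtain z0 where "z0 \<in> W" "z0 \<in> A" "z0 \<notin> Y" using Y by blast
  then have "?Y \<subset> W" using Y assms(5) by blast
  then obtain y z where yz: "y \<in> ?Y" "z \<in> W - ?Y" "(y, z) \<in> E"
    using linkedD[OF assms(1), of ?Y] Y by blast
  then have "z \<in> A" using assms(3) Y by blast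
  moreover from this have "y \<in> Y" using yz no[OF yz(3)] by blast
  ultimately show "\<exists>y\<in>Y. \<exists>z\<in>W \<inter> insert v A - Y. (y, z) \<in> E" using yz by blast
qed (use assms in simp)

text \<open>\<open>A\<close> is one component of \<open>G - v\<close> and \<open>B\<close> the union
  of the others; by \<open>no_cut\<close>, at most \<open>v\<close> is a cut vertex.\<close>

locale split_graph =
  fixes G :: "'a pair_pre_digraph" and v :: 'a and A B :: "'a set"
  assumes graph: "pair_graph G"
    and verts: "pverts G = insert v (A \<union> B)"
    and v_notin: "v \<notin> A" "v \<notin> B" and disjoint: "A \<inter> B = {}" and B_nonempty: "B \<noteq> {}"
    and no_arc: "\<And>x y. (x, y) \<in> parcs G \<Longrightarrow> x \<in> A \<Longrightarrow> y \<in> B \<Longrightarrow> False"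
    and linked_G: "linked (parcs G) (pverts G)"
    and linked_A: "linked (parcs G) A" and card_A: "2 \<le> card A"
    and no_cut: "\<And>w. w \<in> A \<union> B \<Longrightarrow> linked (parcs G) (pverts G - {w})"
begin

abbreviation "E \<equiv> parcs G"
abbreviation "V1 \<equiv> insert v A"
abbreviation "V2 \<equiv> insert v B"
abbreviation "E1 \<equiv> E \<inter> V1 \<times> V1"
text \<open>An undirected edge is the set of its two arcs, so deleting it is a set
  difference.\<close>

abbreviation "edges1 \<equiv> (\<lambda>(x, y). {(x, y), (y, x)}) ` E1"
abbreviation "grown1 \<equiv> {Z. Z \<subseteq> V1 \<and> grows E {v} Z}"
abbreviation "grown2 \<equiv> {Z. Z \<subseteq> V2 \<and> grows E {v} Z}"
abbreviation "linked1 \<equiv> {Z. Z \<subseteq> A \<and> linked E Z}"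

lemmas graphD = pair_graphD[OF graph]

section \<open>Growth, bridges and degrees on the two sides of the cut vertex\<close>

lemma finA: "finite A" and finB: "finite B"
  using graphD(1) by (auto simp: verts)

lemma no_arc': "(x, y) \<in> E \<Longrightarrow> x \<in> B \<Longrightarrow> y \<in> A \<Longrightarrow> False"
  using no_arc symD[OF graphD(3)] by blast

lemma grows_V1: "grows E {v} V1" and grows_V1_del: "w \<in> A \<Longrightarrow> grows E {v} (V1 - {w})"
proof -
  have "grows E {v} (W \<inter> V1)" if "linked E W" "v \<in> W" "W \<subseteq> pverts G" for W
    using grows_side[of E W v A B] that no_arc' v_notin disjoint by (auto simp: verts)
  from this[OF linked_G] this[OF no_cut[of w]]
  show "grows E {v} V1" "w \<in> A \<Longrightarrow> grows E {v} (V1 - {w})"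
    using v_notin by (auto simp: verts Int_absorb1 Diff_Int_distrib2)
qed

lemma grows_V2: "grows E {v} V2" and grows_V2_del: "w \<in> B \<Longrightarrow> grows E {v} (V2 - {w})"
proof -
  have "grows E {v} (W \<inter> V2)" if "linked E W" "v \<in> W" "W \<subseteq> pverts G" for W
    using grows_side[of E W v B A] that no_arc v_notin disjoint by (auto simp: verts)
  from this[OF linked_G] this[OF no_cut[of w]]
  show "grows E {v} V2" "w \<in> B \<Longrightarrow> grows E {v} (V2 - {w})"
    using v_notin by (auto simp: verts Int_absorb1 Diff_Int_distrib2)
qed

lemma card_grown1: "card A * (card A + 1) + 2 \<le> 2 * card grown1"
  using card_grows_ge[of V1 E "{v}"] finA grows_V1 grows_V1_del v_notin by simp

lemma card_grown2: "card B * (card B + 1) + 2 \<le> 2 * card grown2"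
  using card_grows_ge[of V2 E "{v}"] finB grows_V2 grows_V2_del v_notin by simp

lemma card_linked1: "card A * (card A + 1) \<le> 2 * card linked1"
  using card_linked_ge[OF finA graphD(3) linked_A] .

text \<open>Otherwise a single arc from \<open>p\<close> to \<open>q\<close> leaves some cut
  \<open>Y\<close>. If \<open>Y = {v}\<close>, then \<open>q\<close> can be deleted and
  \<open>v\<close> must have another neighbour in \<open>A\<close>, as \<open>A\<close> has at least
  two vertices. If \<open>p = v\<close> and \<open>Y\<close> is larger, connectivity of
  \<open>A\<close> gives a second exit; if \<open>p\<close> lies in \<open>A\<close>, deleting
  \<open>p\<close> does.\<close>

lemma bridgeless:
  assumes "(x, y) \<in> E1"
  shows "grows (E - {(x, y), (y, x)}) {v} V1"
proof (rule growsI, simp)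
  fix Y assume Y: "{v} \<subseteq> Y" "Y \<subset> V1"
  show "\<exists>y'\<in>Y. \<exists>z\<in>V1 - Y. (y', z) \<in> E - {(x, y), (y, x)}"
  proof (rule ccontr)
    assume no: "\<not> ?thesis"
    obtain p q where pq: "p \<in> Y" "q \<in> V1 - Y" "(p, q) \<in> E" using growsD[OF grows_V1 Y] by blast
    with no have "(p, q) \<in> {(x, y), (y, x)}" by blast
    then have sole: "y' = p \<and> z = q" if "y' \<in> Y" "z \<in> V1 - Y" "(y', z) \<in> E" for y' z
      using no that pq by blast
    have "q \<in> A" using pq Y by blast
    show False
    proof (cases "Y = {p}")
      case True
      then have "p = v" using Y by blast
      obtain q' where q': "q' \<in> A" "q' \<noteq> q"
      proof -
        have "A \<noteq> {q}" using card_A by auto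
        then show thesis using that \<open>q \<in> A\<close> by blast
      qed
      have "q' \<in> V1 - {q}" "q' \<noteq> v" using q' v_notin by auto
      then have "{v} \<subset> V1 - {q}" using \<open>q \<in> A\<close> v_notin by blast
      then obtain z where "z \<in> V1 - {q} - {v}" "(v, z) \<in> E"
        using growsD[OF grows_V1_del[OF \<open>q \<in> A\<close>], of "{v}"] by blast
      then show False using sole[of v z] True \<open>p = v\<close> by blast
    next
      case False
      show False
      proof (cases "p = v")
        case True
        have "Y - {v} \<subset> A" "Y - {v} \<noteq> {}" using Y False True pq \<open>q \<in> A\<close> by blast+
        then obtain y' z where "y' \<in> Y - {v}" "z \<in> A - (Y - {v})" "(y', z) \<in> E"
          using linkedD[OF linked_A, of "Y - {v}"] by blast
        then show False using sole[of y' z] True v_notin by blast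
      next
        case False
        then have "p \<in> A" using pq Y by blast
        moreover have "{v} \<subseteq> Y - {p}" "Y - {p} \<subset> V1 - {p}" using Y False pq by blast+
        ultimately obtain y' z where "y' \<in> Y - {p}" "z \<in> V1 - {p} - (Y - {p})" "(y', z) \<in> E"
          using growsD[OF grows_V1_del[of p], of "Y - {p}"] by blast
        then show False using sole[of y' z] by blast
      qed
    qed
  qed
qed

lemma sym_del_edge: "sym (E - {(x, y), (y, x)})"
  using graphD(3) by (auto simp: sym_def)

text \<open>Some edge leaves \<open>{x}\<close>, and by bridgelessness another one does after its
  deletion.\<close>

lemma degree_ge_2:
  assumes "x \<in> V1"
  shows "2 \<le> card (E1 `` {x})"
proof -
  have ne: "{x} \<subset> V1"
  proof -
    have "A \<noteq> {}" using card_A by auto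
    then have "V1 \<noteq> {x}" using v_notin by blast
    then show ?thesis using assms by blast
  qed
  obtain y where y: "y \<in> V1" "(x, y) \<in> E"
    using linkedD[OF grows_imp_linked[OF graphD(3) grows_V1] ne] by blast
  then have "(x, y) \<in> E1" using assms by blast
  from linkedD[OF grows_imp_linked[OF sym_del_edge bridgeless[OF this]] ne]
  obtain z where z: "z \<in> V1" "(x, z) \<in> E" "z \<noteq> y" by blast
  have "card {y, z} \<le> card (E1 `` {x})"
    by (rule card_mono) (use y z assms finA in \<open>auto intro: finite_subset[of _ V1]\<close>)
  then show ?thesis using z by simp
qed

lemma fin_E1: "finite E1"
  by (rule finite_subset[of _ "V1 \<times> V1"]) (use finA in auto)

lemma card_E1: "card E1 = (\<Sum>x\<in>V1. card (E1 `` {x}))"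
proof -
  have "E1 = Sigma V1 (\<lambda>x. E1 `` {x})" by auto
  moreover have "finite (E1 `` {x})" for x
    by (rule finite_subset[of _ V1]) (use finA in auto)
  ultimately show ?thesis using card_SigmaI[of V1 "\<lambda>x. E1 `` {x}"] finA by simp
qed

lemma card_edges1: "card E1 = 2 * card edges1"
proof -
  have "2 * card edges1 = card (\<Union> edges1)"
  proof (rule card_partition)
    show "finite edges1" using fin_E1 by simp
    have "\<Union> edges1 \<subseteq> E1" using graphD(3) by (auto dest: symD)
    then show "finite (\<Union> edges1)" using fin_E1 finite_subset by blast
    show "card q = 2" if "q \<in> edges1" for q
    proof -
      obtain x y where "(x, y) \<in> E" "q = {(x, y), (y, x)}" using \<open>q \<in> edges1\<close> by auto
      moreover from this have "x \<noteq> y" using graphD(4) by (auto simp: irrefl_def)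
      ultimately show ?thesis by simp
    qed
    show "q \<inter> q' = {}" if "q \<in> edges1" "q' \<in> edges1" "q \<noteq> q'" for q q'
      using that by auto
  qed
  moreover have "\<Union> edges1 = E1" using graphD(3) by (auto dest: symD)
  ultimately show ?thesis by simp
qed

text \<open>Handshake count: all degrees are at least 2 and every edge consists of two arcs.\<close>

lemma card_edges1_ge: "card A + 1 \<le> card edges1"
proof -
  have "2 * card V1 \<le> card E1"
    unfolding card_E1 using sum_bounded_below[of V1 2 "\<lambda>x. card (E1 `` {x})"] degree_ge_2 by (simp add: mult.commute)
  then show ?thesis using card_edges1 finA v_notin by simp
qed

text \<open>A larger degree anywhere would make the handshake inequality strict.\<close>

lemma degree_eq_2:
  assumes "card edges1 \<le> card A + 1" "x \<in> V1"
  shows "card (E1 `` {x}) = 2"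
proof (rule ccontr)
  assume "card (E1 `` {x}) \<noteq> 2"
  then have "2 < card (E1 `` {x})" using degree_ge_2[OF assms(2)] by simp
  then have "(\<Sum>x\<in>V1. 2) < (\<Sum>x\<in>V1. card (E1 `` {x}))"
    using finA assms(2) degree_ge_2 by (intro sum_strict_mono_ex1) auto
  then show False using assms(1) card_edges1 finA v_notin unfolding card_E1[symmetric] by simp
qed

section \<open>Lower bound for the number of connected subgraphs\<close>

definition induced :: "'a set \<Rightarrow> 'a pair_pre_digraph" where
  "induced X = \<lparr>pverts = X, parcs = E \<inter> X \<times> X\<rparr>"

text \<open>Keeping all of \<open>V1\<close> makes bridgelessness apply to the deleted edge
  \<open>q\<close>, while \<open>Z\<close> ranges over the rooted sets on the side of
  \<open>B\<close>.\<close>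

definition del_edge :: "'a rel \<Rightarrow> 'a set \<Rightarrow> 'a pair_pre_digraph" where
  "del_edge q Z = \<lparr>pverts = V1 \<union> Z, parcs = E \<inter> (V1 \<union> Z) \<times> (V1 \<union> Z) - q\<rparr>"

text \<open>Sets through \<open>v\<close> combine one rooted set from each side, whence a product in
  the count. \<open>B\<close> may fall into several components, so only its singletons are
  taken.\<close>

definition linked_sets :: "'a set set" where
  "linked_sets = (\<lambda>(Z1, Z2). Z1 \<union> Z2) ` (grown1 \<times> grown2) \<union> linked1 \<union> (\<lambda>x. {x}) ` B"

lemma card_linked_sets: "card linked_sets = card grown1 * card grown2 + card linked1 + card B"
proof -
  let ?P = "(\<lambda>(Z1, Z2). Z1 \<union> Z2) ` (grown1 \<times> grown2)"
  have root: "v \<in> Z" if "grows E {v} Z" for Z using grows_subset[OF that] by simp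
  have fin: "finite grown1" "finite grown2" "finite linked1" using finA finB by simp_all
  have "inj_on (\<lambda>(Z1, Z2). Z1 \<union> Z2) (grown1 \<times> grown2)"
  proof (rule inj_onI)
    \<comment> \<open>Both sets contain \<open>v\<close>, the only common vertex of the two sides,
      so each is recovered by intersection.\<close>
    have id: "Z1 = (Z1 \<union> Z2) \<inter> V1 \<and> Z2 = (Z1 \<union> Z2) \<inter> V2" if "Z1 \<in> grown1" "Z2 \<in> grown2" for Z1 Z2
      using that root[of Z1] root[of Z2] disjoint by blast
    fix P Q assume PQ: "P \<in> grown1 \<times> grown2" "Q \<in> grown1 \<times> grown2"
      and eq: "(case P of (Z1, Z2) \<Rightarrow> Z1 \<union> Z2) = (case Q of (Z1, Z2) \<Rightarrow> Z1 \<union> Z2)"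
    then have "fst P \<union> snd P = fst Q \<union> snd Q" by (simp add: case_prod_beta)
    then have "fst P = fst Q" "snd P = snd Q"
      using id[of "fst P" "snd P"] id[of "fst Q" "snd Q"] PQ by (auto simp: mem_Times_iff)
    then show "P = Q" by (rule prod_eqI)
  qed
  then have P: "card ?P = card grown1 * card grown2"
    by (simp add: card_image card_cartesian_product)
  have S: "card ((\<lambda>x. {x}) ` B) = card B" by (simp add: card_image)
  have "?P \<inter> linked1 = {}" using root v_notin by blast
  then have "card (?P \<union> linked1) = card ?P + card linked1"
    using fin by (intro card_Un_disjoint) auto
  moreover have "Z \<notin> (\<lambda>x. {x}) ` B" if "Z \<in> ?P \<union> linked1" for Z
  proof
    assume "Z \<in> (\<lambda>x. {x}) ` B"
    then obtain x where x: "Z = {x}" "x \<in> B" by blast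
    then have "\<not> Z \<subseteq> A" "v \<notin> Z" using disjoint v_notin by auto
    then show False using that root by blast
  qed
  then have "(?P \<union> linked1) \<inter> (\<lambda>x. {x}) ` B = {}" unfolding disjoint_iff by iprover
  then have "card linked_sets = card (?P \<union> linked1) + card ((\<lambda>x. {x}) ` B)"
    unfolding linked_sets_def using fin finB by (intro card_Un_disjoint) auto
  ultimately show ?thesis using P S by simp
qed

lemma induced_connected:
  assumes "X \<in> linked_sets"
  shows "induced X \<in> connected_subgraphs G"
proof -
  have "X \<subseteq> pverts G \<and> linked E X"
    using assms grows_imp_linked[OF graphD(3) grows_Un[of E "{v}"]] unfolding linked_sets_def
    by (auto simp: verts)
  then show ?thesis
    unfolding induced_def in_connected_subgraphs_iff[OF graph]
    using graphD(3) linked_mono_rel[of E X "E \<inter> X \<times> X"] by (auto simp: sym_def)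
qed

lemma del_edge_connected:
  assumes "q \<in> edges1" "Z \<in> grown2"
  shows "del_edge q Z \<in> connected_subgraphs G"
proof -
  obtain x y where xy: "(x, y) \<in> E1" "q = {(x, y), (y, x)}" using assms(1) by auto
  have "x \<noteq> y" using xy graphD(4) by (auto simp: irrefl_def)
  \<comment> \<open>\<open>q\<close> joins two distinct vertices of \<open>V1\<close>, and
    \<open>Z\<close> meets \<open>V1\<close> in \<open>v\<close> only, so no arc of \<open>q\<close>
    lies inside \<open>Z\<close>.\<close>
  have "grows (E - q) {v} Z"
    by (rule grows_mono_rel[of E])
      (use assms(2) xy \<open>x \<noteq> y\<close> disjoint v_notin in \<open>auto simp: disjoint_iff\<close>)
  then have "grows (E - q) {v} (V1 \<union> Z)"
    using bridgeless[OF xy(1)] xy(2) by (intro grows_Un) auto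
  then have l: "linked (E - q) (V1 \<union> Z)"
    using sym_del_edge[of x y] xy(2) by (intro grows_imp_linked) auto
  have "sym (E \<inter> (V1 \<union> Z) \<times> (V1 \<union> Z) - q)"
    using graphD(3) xy(2) by (auto simp: sym_def)
  moreover have "V1 \<union> Z \<subseteq> pverts G" using assms(2) by (auto simp: verts)
  moreover have "linked (E \<inter> (V1 \<union> Z) \<times> (V1 \<union> Z) - q) (V1 \<union> Z)"
    by (rule linked_mono_rel[OF l]) auto
  ultimately show ?thesis unfolding del_edge_def in_connected_subgraphs_iff[OF graph] by blast
qed

lemma F_ge:
  "card grown1 * card grown2 + card linked1 + card B + card edges1 * card grown2 \<le> F G"
proof -
  let ?I = "induced ` linked_sets"
  let ?D = "(\<lambda>(q, Z). del_edge q Z) ` (edges1 \<times> grown2)"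
  have root: "v \<in> Z" if "Z \<in> grown2" for Z using that grows_subset[of E "{v}" Z] by simp
  have q_sub: "q \<subseteq> E \<inter> (V1 \<union> Z) \<times> (V1 \<union> Z)" "q \<noteq> {}" if "q \<in> edges1" for q Z
    using that graphD(3) by (auto dest: symD)
  have "inj_on induced linked_sets" by (auto intro!: inj_onI simp: induced_def)
  then have I: "card ?I = card linked_sets" by (rule card_image)
  have "inj_on (\<lambda>(q, Z). del_edge q Z) (edges1 \<times> grown2)"
  proof (rule inj_onI)
    \<comment> \<open>Both parameters can be read off: \<open>Z\<close> is the part in
      \<open>V2\<close>, and \<open>q\<close> is the set of arcs missing between the
      vertices.\<close>
    have id: "Z = pverts (del_edge q Z) \<inter> V2"
      "q = E \<inter> pverts (del_edge q Z) \<times> pverts (del_edge q Z) - parcs (del_edge q Z)"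
      if "q \<in> edges1" "Z \<in> grown2" for q Z
    proof -
      show "Z = pverts (del_edge q Z) \<inter> V2"
        using that root[of Z] disjoint unfolding del_edge_def by auto
      show "q = E \<inter> pverts (del_edge q Z) \<times> pverts (del_edge q Z) - parcs (del_edge q Z)"
        using q_sub(1)[OF that(1), of Z] unfolding del_edge_def by auto
    qed
    fix P Q assume PQ: "P \<in> edges1 \<times> grown2" "Q \<in> edges1 \<times> grown2"
      and "(case P of (q, Z) \<Rightarrow> del_edge q Z) = (case Q of (q, Z) \<Rightarrow> del_edge q Z)"
    then have eq: "del_edge (fst P) (snd P) = del_edge (fst Q) (snd Q)" by (simp add: case_prod_beta)
    have p: "fst P \<in> edges1" "snd P \<in> grown2" and q: "fst Q \<in> edges1" "snd Q \<in> grown2"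
      using PQ by (simp_all only: mem_Times_iff)
    have "fst P = fst Q"
      by (rule trans[OF id(2)[OF p] trans[OF _ id(2)[OF q, symmetric]]]) (simp only: eq)
    moreover have "snd P = snd Q"
      by (rule trans[OF id(1)[OF p] trans[OF _ id(1)[OF q, symmetric]]]) (simp only: eq)
    ultimately show "P = Q" by (rule prod_eqI)
  qed
  then have D: "card ?D = card edges1 * card grown2"
    by (simp only: card_image card_cartesian_product)
  \<comment> \<open>A subgraph in \<open>?D\<close> lacks an edge of \<open>G\<close> between two of
    its vertices and is therefore not induced.\<close>
  have "?I \<inter> ?D = {}"
  proof (rule ccontr)
    assume "?I \<inter> ?D \<noteq> {}"
    then obtain X q Z where q: "q \<in> edges1" and eq: "induced X = del_edge q Z" by auto
    have "X = V1 \<union> Z"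
      using arg_cong[OF eq, of pverts] by (simp add: induced_def del_edge_def)
    moreover have "E \<inter> X \<times> X = E \<inter> (V1 \<union> Z) \<times> (V1 \<union> Z) - q"
      using arg_cong[OF eq, of parcs] unfolding induced_def del_edge_def pair_pre_digraph.simps .
    ultimately show False using q_sub(1)[OF q, of Z] q_sub(2)[OF q] by blast
  qed
  moreover have "finite ?I" "finite ?D"
    using finA finB fin_E1 by (auto simp: linked_sets_def)
  ultimately have "card ?I + card ?D = card (?I \<union> ?D)" by (simp only: card_Un_disjoint)
  also have "\<dots> \<le> card (connected_subgraphs G)"
    by (rule card_mono[OF finite_connected_subgraphs[OF graph]])
      (use induced_connected del_edge_connected in auto)
  finally show ?thesis unfolding F_def I D card_linked_sets .
qed

section \<open>The equality case\<close>

lemma linked_E1: "linked E1 V1"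
  by (rule linked_mono_rel[OF grows_imp_linked[OF graphD(3) grows_V1]]) simp

text \<open>With at most as many edges as vertices, \<open>V1\<close> is two-regular and connected,
  hence a cycle, here started at \<open>v\<close>. The single vertex \<open>p\<close> of
  \<open>B\<close> can only be adjacent to \<open>v\<close>.\<close>

lemma lollipop_if_tight:
  assumes "card B = 1" "card edges1 \<le> card A + 1"
  obtains c p where "lollipop (card A + 1) c p" "G = lollipop_graph c p"
proof -
  obtain p where p: "B = {p}" using assms(1) by (auto simp: card_1_singleton_iff)
  have "sym E1" "irrefl E1" using graphD(3,4) by (auto simp: sym_def irrefl_def)
  then obtain c where c: "c 0 = v" "\<And>i. c (i + card V1) = c i" "inj_on c {..<card V1}"
    "range c = V1" "path_arcs c UNIV = E1"
    using two_regular_obtain_cycle[of V1 E1 v] degree_eq_2[OF assms(2)] linked_E1 finA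
    by (metis Int_lower2 finite_insert insertI1)
  have card: "card V1 = card A + 1" using finA v_notin by simp
  have "lollipop (card A + 1) c p"
    by unfold_locales (use c card card_A p v_notin disjoint in auto)
  moreover have "G = lollipop_graph c p"
  proof -
    have "(v, p) \<in> E"
      using growsD[OF grows_V2, of "{v}"] p v_notin by blast
    moreover have "E \<subseteq> E1 \<union> {(v, p), (p, v)}"
    proof
      fix a assume a: "a \<in> E"
      obtain x y where xy: "a = (x, y)" by fastforce
      have "x \<in> insert v (insert p A)" "y \<in> insert v (insert p A)" "x \<noteq> y"
        using a xy graphD(2,4) p by (auto simp: verts irrefl_def)
      then show "a \<in> E1 \<union> {(v, p), (p, v)}"
        using a no_arc[of x y] no_arc'[of x y] p unfolding xy by blast
    qed
    ultimately have "E = E1 \<union> {(c 0, p), (p, c 0)}" using c(1) symD[OF graphD(3)] by blast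
    then show ?thesis unfolding lollipop_graph_def
      using verts p c(4,5) by (intro pair_pre_digraph.equality) auto
  qed
  ultimately show thesis by (rule that)
qed

end

text \<open>Compares the lower bound for a split graph with twice the upper bound for the lollipop
  with \<open>m = a + b\<close>. The counts come doubled, so their product is bounded four times
  over and \<open>le\<close> is doubled to match.\<close>

lemma tight_counts:
  fixes a b cA cB l q :: nat
  assumes "2 \<le> a" "1 \<le> b" "a * (a + 1) + 2 \<le> 2 * cA" "b * (b + 1) + 2 \<le> 2 * cB"
    "a * (a + 1) \<le> 2 * l" "a + 1 \<le> q"
    and le: "2 * (cA * cB + l + b + q * cB) \<le> 3 * (a + b) * (a + b) + (a + b) + 6"
  shows "b = 1 \<and> q = a + 1"
proof -
  have "(a * (a + 1) + 2 + 2 * q) * (b * (b + 1) + 2) \<le> (2 * cA + 2 * q) * (2 * cB)"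
    using assms by (intro mult_mono) auto
  moreover have "(2 * cA + 2 * q) * (2 * cB) = 4 * (cA * cB + q * cB)" by (simp add: algebra_simps)
  moreover have "4 * (cA * cB + q * cB) + 4 * l + 4 * b \<le> 6 * ((a + b) * (a + b)) + 2 * (a + b) + 12"
    using mult_le_mono2[OF le, of 2] by (simp add: algebra_simps)
  moreover have "X + 2 * Y + 4 * b \<le> R"
    if "X \<le> Z" "Z = 4 * W" "4 * W + 4 * l + 4 * b \<le> R" "Y \<le> 2 * l" for X Y Z W R :: nat
    using that by linarith
  ultimately have main: "(a * (a + 1) + 2 + 2 * q) * (b * (b + 1) + 2) + 2 * (a * (a + 1)) + 4 * b
      \<le> 6 * ((a + b) * (a + b)) + 2 * (a + b) + 12"
    using assms(5) by blast
  have "b = 1"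
  proof (rule ccontr)
    assume "b \<noteq> 1"
    \<comment> \<open>After substituting \<open>a = x + 2\<close> and \<open>b = y + 2\<close>, the
      left side dominates the right coefficient by coefficient, with the strictly larger constant
      term.\<close>
    then obtain y where y: "b = y + 2" using assms(2) by (metis Suc_1 add.commute add_2_eq_Suc' le_neq_implies_less le_Suc_ex Suc_leI)
    obtain x where x: "a = x + 2" using assms(1) by (metis add.commute le_Suc_ex)
    have "(a * (a + 1) + 2 + 2 * (a + 1)) * (b * (b + 1) + 2) \<le> (a * (a + 1) + 2 + 2 * q) * (b * (b + 1) + 2)"
      using assms(6) by (intro mult_right_mono) auto
    with main have "(a * (a + 1) + 2 + 2 * (a + 1)) * (b * (b + 1) + 2) + 2 * (a * (a + 1)) + 4 * b
      \<le> 6 * ((a + b) * (a + b)) + 2 * (a + b) + 12" by linarith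
    then show False unfolding x y by (simp add: algebra_simps)
  qed
  \<comment> \<open>For \<open>b = 1\<close> the inequality reduces to \<open>8 * q\<close> \<le>
    \<open>8 * a + 8\<close>.\<close>
  then show ?thesis using main assms(6) by simp
qed

section \<open>The extremal graph\<close>

lemma end_in_pawalk_verts: "pcas x es y \<Longrightarrow> y \<in> set (pawalk_verts x es)"
  by (induction es arbitrary: x) auto

lemma start_in_pawalk_verts: "pcas x es y \<Longrightarrow> x \<in> set (pawalk_verts x es)"
  by (cases es) auto

text \<open>Among three consecutive arcs one avoids \<open>v\<close>: the third if \<open>v\<close>
  is the head of the first, and otherwise one of the first two, whose outer ends differ.\<close>

lemma cycle_obtain_arc_avoiding:
  assumes "pre_digraph.cycle (with_proj G) w" "3 \<le> length w"
  obtains x y where "(x, y) \<in> parcs G" "x \<noteq> v" "y \<noteq> v"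
proof -
  obtain u where u: "set w \<subseteq> parcs G" "pcas u w u" "distinct (tl (pawalk_verts u w))"
    using assms(1)
    by (auto simp: pre_digraph.cycle_def pre_digraph.awalk_def cas_with_proj_eq awalk_verts_with_proj_eq)
  obtain e1 e2 e3 es where w: "w = e1 # e2 # e3 # es"
    using assms(2) by (auto simp: numeral_3_eq_3 Suc_le_length_iff)
  have walk: "fst e1 = u" "fst e2 = snd e1" "fst e3 = snd e2" "pcas (snd e3) es u"
    using u(2) by (auto simp: w)
  have d: "snd e1 \<noteq> snd e2" "snd e1 \<notin> set (pawalk_verts (snd e3) es)"
    "snd e2 \<notin> set (pawalk_verts (snd e3) es)"
    using u(3) walk by (auto simp: w)
  then have ne: "snd e1 \<noteq> snd e3" "snd e2 \<noteq> snd e3" "snd e2 \<noteq> u"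
    using start_in_pawalk_verts[OF walk(4)] end_in_pawalk_verts[OF walk(4)] by auto
  have arcs: "(u, snd e1) \<in> parcs G" "(snd e1, snd e2) \<in> parcs G" "(snd e2, snd e3) \<in> parcs G"
    using u(1) walk prod.collapse[of e1] prod.collapse[of e2] prod.collapse[of e3]
    unfolding w by (metis list.set_intros subsetD)+
  show thesis
  proof (cases "v = snd e1")
    case True
    then show ?thesis using that[OF arcs(3)] d ne by auto
  next
    case False
    then show ?thesis using that[OF arcs(1)] that[OF arcs(2)] ne by metis
  qed
qed

text \<open>\<open>A\<close> is the component of \<open>G - v\<close> that contains an edge of a
  cycle avoiding \<open>v\<close>, which gives it two vertices. \<open>B\<close> is nonempty because
  \<open>G - v\<close> is disconnected.\<close>

lemma obtain_split:
  assumes "G \<in> non_tree_graphs_with_cut_vertices n 1"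
  obtains v A B where "split_graph G v A B"
proof -
  let ?E = "parcs G" and ?V = "pverts G"
  have G: "pair_graph G" and conn: "Digraph_Component.connected (with_proj G)"
    and "card {v. cut_vertex G v} = 1" and tree: "\<not> undirected_tree G"
    using assms by (auto simp: non_tree_graphs_with_cut_vertices_def graphs_with_cut_vertices_def)
  then obtain v where "{v. cut_vertex G v} = {v}" by (auto simp: card_1_singleton_iff)
  then have cut: "cut_vertex G w \<longleftrightarrow> w = v" for w by blast
  note graphD = pair_graphD[OF G]
  have l: "linked ?E ?V" using conn connected_iff_linked[OF G] by simp
  have v: "v \<in> ?V" "\<not> linked ?E (?V - {v})" and no_cut: "linked ?E (?V - {w})" if "w \<in> ?V - {v}" for w
    using cut[of v] cut[of w] that unfolding cut_vertex_iff[OF G conn] by auto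
  obtain x y where xy: "(x, y) \<in> ?E" "x \<noteq> v" "y \<noteq> v"
    using tree conn cycle_obtain_arc_avoiding[of G _ v] unfolding undirected_tree_def by metis
  then have xyV: "x \<in> ?V - {v}" "y \<in> ?V - {v}" "x \<noteq> y"
    using graphD(2,4) by (auto simp: irrefl_def)
  define A where "A = {z. (x, z) \<in> rtrancl_on (?V - {v}) ?E}"
  define B where "B = ?V - {v} - A"
  have A_sub: "A \<subseteq> ?V - {v}" unfolding A_def using in_rtrancl_on_in_F by fastforce
  have x_A: "x \<in> A" using xyV by (simp add: A_def)
  have step: "t \<in> A" if "s \<in> A" "(s, t) \<in> ?E" "t \<in> ?V - {v}" for s t
    using that unfolding A_def by (auto intro: rtrancl_on_into_rtrancl_on)
  \<comment> \<open>Every vertex on a walk from \<open>x\<close> in \<open>G - v\<close> is itself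
    reached from \<open>x\<close>, so the walk stays in \<open>A\<close>.\<close>
  have "(x, z) \<in> rtrancl_on A ?E" if "(x, z) \<in> rtrancl_on (?V - {v}) ?E" for z
    using that
  proof (induction rule: rtrancl_on_induct)
    case base
    then show ?case using x_A by simp
  next
    case (step s t)
    then have "t \<in> A" unfolding A_def by (auto intro: rtrancl_on_into_rtrancl_on)
    then show ?case using step by (auto intro: rtrancl_on_into_rtrancl_on)
  qed
  then have "grows ?E {x} A" using x_A by (auto simp: grows_iff_rtrancl_on A_def)
  then have lA: "linked ?E A" by (rule grows_imp_linked[OF graphD(3)])
  have "card {x, y} \<le> card A"
    by (rule card_mono) (use A_sub graphD(1) finite_subset x_A step[OF x_A xy(1) xyV(2)] in auto)
  then have card_A: "2 \<le> card A" using xyV by simp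
  have B_ne: "B \<noteq> {}"
  proof
    assume "B = {}"
    then have "A = ?V - {v}" using A_sub by (auto simp: B_def)
    then show False using lA v(2)[OF xyV(1)] by simp
  qed
  have V: "?V = insert v (A \<union> B)" using A_sub v(1)[OF xyV(1)] by (auto simp: B_def)
  have "split_graph G v A B"
  proof (rule split_graph.intro[OF G V])
    show "A \<inter> B = {}" "v \<notin> A" "v \<notin> B" using A_sub by (auto simp: B_def)
    show False if "(s, t) \<in> ?E" "s \<in> A" "t \<in> B" for s t
      using step[OF that(2,1)] that(3) by (auto simp: B_def)
    show "linked ?E (?V - {w})" if "w \<in> A \<union> B" for w
      using no_cut[of w] that A_sub by (auto simp: B_def)
  qed (fact B_ne l lA card_A)+
  then show thesis by (rule that)
qed

theorem theorem4p7:
  fixes n :: nat and G\<^sub>0 :: "'a pair_pre_digraph"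
  assumes "n \<ge> 4"
    and "G\<^sub>0 \<in> non_tree_graphs_with_cut_vertices n 1"
    and "F G\<^sub>0 = Min (F ` (non_tree_graphs_with_cut_vertices n 1 :: 'a pair_pre_digraph set))"
  shows "digraph_iso (with_proj G\<^sub>0) (with_proj (L_graph n))"
proof -
  obtain v A B where "split_graph G\<^sub>0 v A B" using obtain_split[OF assms(2)] .
  then interpret split_graph G\<^sub>0 v A B .
  define m where "m = n - 1"
  have n: "n = Suc m" "3 \<le> m" using assms(1) by (auto simp: m_def)
  have card_V: "card (pverts G\<^sub>0) = n"
    using assms(2) by (simp add: non_tree_graphs_with_cut_vertices_def graphs_with_cut_vertices_def)
  have "card (A \<union> B) = card A + card B" using finA finB disjoint by (rule card_Un_disjoint)
  then have ab: "card A + card B = m"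
    using card_V finA finB v_notin by (simp add: verts n)
  \<comment> \<open>The minimum ranges over graphs on the type \<open>'a\<close>, so the competing
    lollipop is built on an enumeration of the vertices of the given graph, with \<open>h m\<close>
    as the pendant vertex.\<close>
  obtain h where h: "bij_betw h {..<n} (pverts G\<^sub>0)"
    using ex_bij_betw_nat_finite[OF graphD(1)] card_V by (auto simp: atLeast0LessThan)
  define c where "c i = h (i mod m)" for i
  have inj: "inj_on h {..<n}" using h by (rule bij_betw_imp_inj_on)
  interpret L: lollipop m c "h m"
  proof
    show "3 \<le> m" by (fact n)
    show "c (i + m) = c i" for i by (simp add: c_def)
    show "inj_on c {..<m}"
      by (rule inj_onI) (auto simp: c_def n intro: inj_onD[OF inj])
    have "h m \<noteq> c i" for i
    proof
      assume "h m = c i"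
      moreover have "i mod m < m" using n by simp
      ultimately have "m = i mod m" unfolding c_def by (intro inj_onD[OF inj]) (auto simp: n)
      with \<open>i mod m < m\<close> show False by simp
    qed
    then show "h m \<notin> range c" by blast
  qed
  have "F G\<^sub>0 \<le> F (lollipop_graph c (h m))"
    unfolding assms(3) by (rule Min_le[OF finite_F_values]) (use L.lollipop_in_class n in auto)
  then have F_le: "2 * F G\<^sub>0 \<le> 3 * m * m + m + 6" using L.F_lollipop_le by linarith
  have "1 \<le> card B" using B_nonempty finB by (simp add: Suc_le_eq card_gt_0_iff)
  then have tight: "card B = 1 \<and> card edges1 = card A + 1"
    using tight_counts[OF card_A _ card_grown1 card_grown2 card_linked1 card_edges1_ge, unfolded ab]
      order.trans[OF mult_le_mono2[OF F_ge] F_le] by blast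
  then obtain c' p where "lollipop (card A + 1) c' p" "G\<^sub>0 = lollipop_graph c' p"
    using lollipop_if_tight by (metis order_refl)
  moreover have "card A + 1 = m" using tight ab by simp
  ultimately show ?thesis using lollipop.lollipop_iso_L_graph n by metis
qed

end
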